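(* Let $(G_t)_{t\ge0}$ be the growing directed graph generated by the generalized Aiello--Chung--Lu directed model with random sequences $(X_t),(Y_t),(Z_t),(Q_t)$ (defined in the context). Let $\ell=\ell(n)$ and $u=u(n)$ be positive integers such that $\ell\le X_t+Y_t+Z_t+Q_t\le u$ for all $t\in\mathbb N$. Then there is a constant $C$, not depending on $n$, such that asymptotically almost surely (as $n\to\infty$) the diameter of $G_n$ is at most $4e(u/\ell)\log n+8eu+C$.
   Context: Conventions: $\mathbb N=\{1,2,\dots\}$, $\mathbb N_0=\{0,1,2,\dots\}$; $\log$ is the natural logarithm and $e$ its base. Graphs are finite and may have loops and parallel edges. Distance between two vertices of a directed graph is the number of edges in a shortest path ignoring edge directions; the diameter is the maximum distance between two vertices. The initial graph $G_0$ is finite of size $O(1)$ (bounded independently of $n$). "Asymptotically almost surely" means with probability tending to $1$ as $n\to\infty$. Random choices at time $t$ have the stated distributions conditionally on the history of the process up to time $t-1$ and on the values $X_t,Y_t,Z_t,Q_t$. For a directed graph $G$ with at least one edge, $\rho_0^{out}(v)=\operatorname{out-deg}(v)/\sum_{u\in V(G)}\operatorname{out-deg}(u)$ and $\rho_0^{in}(v)=\operatorname{in-deg}(v)/\sum_{u\in V(G)}\operatorname{in-deg}(u)$ for $v\in V(G)$. Model: $(X_t),(Y_t),(Z_t),(Q_t)$, $t\in\mathbb N$, are sequences of $\mathbb N_0$-valued random variables satisfying $X_t+Y_t>0$ for all $t$. $G_0$ is an arbitrary weakly connected directed graph with at least one edge. At each time-step $t\in\mathbb N$, $G_t$ is obtained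 from $G_{t-1}$ as follows. 1. Sample $X_t$ vertices $x_1,\dots,x_{X_t}$ of $G_{t-1}$ independently using $\rho_0^{out}$ and $Y_t$ vertices $y_1,\dots,y_{Y_t}$ of $G_{t-1}$ independently using $\rho_0^{in}$. 2. Sample $Z_t$ vertices $w_1,\dots,w_{Z_t}$ of $G_{t-1}$ independently using $\rho_0^{out}$ and $Z_t$ vertices $w_1',\dots,w_{Z_t}'$ of $G_{t-1}$ independently using $\rho_0^{in}$. 3. Add a new vertex $v$, and then add the directed edges $w_1w_1',\dots,w_{Z_t}w_{Z_t}'$, $x_1v,\dots,x_{X_t}v$, $vy_1,\dots,vy_{Y_t}$; also add $Q_t$ loops at $v$. *)

theory Defs
  imports "HOL-Probability.Probability" "Graph_Theory.Graph_Theory"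
begin

text \<open>
  Directed multigraphs are the arc-labelled digraphs of \<^verbatim>\<open>Graph_Theory\<close> (loops and parallel arcs
  allowed).  Weak connectedness is \<^verbatim>\<open>Digraph_Component.connected\<close>, i.e. strong connectedness
  of the underlying symmetric graph.
\<close>

definition rho_out :: "('v, 'e) pre_digraph \<Rightarrow> 'v \<Rightarrow> real" where
  "rho_out G v = real (out_degree G v) / real (\<Sum>u\<in>verts G. out_degree G u)"

definition rho_in :: "('v, 'e) pre_digraph \<Rightarrow> 'v \<Rightarrow> real" where
  "rho_in G v = real (in_degree G v) / real (\<Sum>u\<in>verts G. in_degree G u)"

text \<open>Distances ignore edge directions; they are infinite between different weak components.\<close>

definition undirected_dist :: "('v, 'e) pre_digraph \<Rightarrow> 'v \<Rightarrow> 'v \<Rightarrow> ereal" where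
  "undirected_dist G u v =
     (INF p\<in>{p. pre_digraph.apath (with_proj (mk_symmetric G)) u p v}. ereal (real (length p)))"

definition digraph_diameter :: "('v, 'e) pre_digraph \<Rightarrow> ereal" where
  "digraph_diameter G = (SUP u\<in>verts G. SUP v\<in>verts G. undirected_dist G u v)"

text \<open>
  The vertex added at time \<open>t\<close> is \<open>Inr t\<close>, and the \<open>i\<close>-th edge added at time \<open>t\<close> is \<open>Inr (t, i)\<close>;
  the vertices and edges of the initial graph are tagged by \<open>Inl\<close>.  A selection
  \<open>(xs, ys, ws, ws')\<close> lists the vertices sampled in one step.
\<close>

type_synonym 'v vtx = "'v + nat"
type_synonym 'e edg = "'e + nat \<times> nat"
type_synonym 'v selection = "'v list \<times> 'v list \<times> 'v list \<times> 'v list"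

definition initial_graph :: "('v, 'e) pre_digraph \<Rightarrow> ('v vtx, 'e edg) pre_digraph" where
  "initial_graph G0 =
     \<lparr> verts = Inl ` verts G0,
       arcs = Inl ` arcs G0,
       tail = (\<lambda>a. case a of Inl e \<Rightarrow> Inl (tail G0 e) | Inr _ \<Rightarrow> undefined),
       head = (\<lambda>a. case a of Inl e \<Rightarrow> Inl (head G0 e) | Inr _ \<Rightarrow> undefined) \<rparr>"

fun new_edges :: "'v \<Rightarrow> nat \<Rightarrow> 'v selection \<Rightarrow> ('v \<times> 'v) list" where
  "new_edges v q (xs, ys, ws, ws') =
     zip ws ws' @ map (\<lambda>x. (x, v)) xs @ map (\<lambda>y. (v, y)) ys @ replicate q (v, v)"

definition grow ::
  "nat \<Rightarrow> nat \<Rightarrow> 'v vtx selection \<Rightarrow> ('v vtx, 'e edg) pre_digraph \<Rightarrow> ('v vtx, 'e edg) pre_digraph"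
where
  "grow t q s G =
     (let L = new_edges (Inr t) q s in
      \<lparr> verts = insert (Inr t) (verts G),
        arcs = arcs G \<union> {Inr (t, i) | i. i < length L},
        tail = (\<lambda>a. case a of Inl _ \<Rightarrow> tail G a
                   | Inr (r, i) \<Rightarrow> if r = t then fst (L ! i) else tail G a),
        head = (\<lambda>a. case a of Inl _ \<Rightarrow> head G a
                   | Inr (r, i) \<Rightarrow> if r = t then snd (L ! i) else head G a) \<rparr>)"

primrec acl_graph ::
  "('v, 'e) pre_digraph \<Rightarrow> (nat \<Rightarrow> nat) \<Rightarrow> (nat \<Rightarrow> 'v vtx selection) \<Rightarrow> nat \<Rightarrow>
   ('v vtx, 'e edg) pre_digraph"
where
  "acl_graph G0 q s 0 = initial_graph G0"
| "acl_graph G0 q s (Suc t) = grow (Suc t) (q (Suc t)) (s (Suc t)) (acl_graph G0 q s t)"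

text \<open>
  Probability of a selection when \<open>a\<close>, \<open>b\<close>, \<open>c\<close>, \<open>c\<close> vertices are sampled independently, using
  \<open>rho_out\<close>, \<open>rho_in\<close>, \<open>rho_out\<close>, \<open>rho_in\<close> respectively.
\<close>

fun selection_prob :: "('v, 'e) pre_digraph \<Rightarrow> nat \<Rightarrow> nat \<Rightarrow> nat \<Rightarrow> 'v selection \<Rightarrow> real" where
  "selection_prob G a b c (xs, ys, ws, ws') =
     (if length xs = a \<and> length ys = b \<and> length ws = c \<and> length ws' = c
      then prod_list (map (rho_out G) xs) * prod_list (map (rho_in G) ys) *
           prod_list (map (rho_out G) ws) * prod_list (map (rho_in G) ws')
      else 0)"

text \<open>
  The process.  \<open>S t\<close> is the selection made at time \<open>t\<close>.  The variables \<open>X\<close>, \<open>Y\<close>, \<open>Z\<close>, \<open>Q\<close> may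
  have any joint distribution and may depend on the past.  All variables are discrete, so
  the law of \<open>S t\<close> given the past and \<open>X t\<close>, \<open>Y t\<close>, \<open>Z t\<close>, \<open>Q t\<close> is described by elementary
  conditioning on the atoms of positive probability; the atom is named by one of its points \<open>\<omega>\<^sub>0\<close>,
  so that the graph at time \<open>t - 1\<close> is the one determined by \<open>\<omega>\<^sub>0\<close>.  Countability of the type of
  initial vertices makes every event about finitely many steps measurable.
\<close>

locale acl_process = prob_space M
  for M :: "'w measure" +
  fixes G0 :: "('v :: countable, 'e) pre_digraph"
    and X Y Z Q :: "nat \<Rightarrow> 'w \<Rightarrow> nat"
    and S :: "nat \<Rightarrow> 'w \<Rightarrow> 'v vtx selection"
  assumes fin_digraph_G0: "fin_digraph G0"
    and weakly_connected_G0: "Digraph_Component.connected G0"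
    and arcs_G0: "arcs G0 \<noteq> {}"
    and rv_X: "\<And>t. t \<ge> 1 \<Longrightarrow> X t \<in> M \<rightarrow>\<^sub>M count_space UNIV"
    and rv_Y: "\<And>t. t \<ge> 1 \<Longrightarrow> Y t \<in> M \<rightarrow>\<^sub>M count_space UNIV"
    and rv_Z: "\<And>t. t \<ge> 1 \<Longrightarrow> Z t \<in> M \<rightarrow>\<^sub>M count_space UNIV"
    and rv_Q: "\<And>t. t \<ge> 1 \<Longrightarrow> Q t \<in> M \<rightarrow>\<^sub>M count_space UNIV"
    and rv_S: "\<And>t. t \<ge> 1 \<Longrightarrow> S t \<in> M \<rightarrow>\<^sub>M count_space UNIV"
    and XY_pos: "\<And>t. t \<ge> 1 \<Longrightarrow> AE \<omega> in M. X t \<omega> + Y t \<omega> > 0"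
    and cond_selection:
      "\<And>t \<omega>\<^sub>0 s.
        t \<ge> 1 \<Longrightarrow> \<omega>\<^sub>0 \<in> space M \<Longrightarrow>
        \<P>(\<omega> in M. (\<forall>r\<in>{1..<t}. S r \<omega> = S r \<omega>\<^sub>0) \<and>
          (\<forall>r\<in>{1..t}. X r \<omega> = X r \<omega>\<^sub>0 \<and> Y r \<omega> = Y r \<omega>\<^sub>0 \<and> Z r \<omega> = Z r \<omega>\<^sub>0 \<and> Q r \<omega> = Q r \<omega>\<^sub>0)) > 0 \<Longrightarrow>
        \<P>(\<omega> in M. S t \<omega> = s \<bar> (\<forall>r\<in>{1..<t}. S r \<omega> = S r \<omega>\<^sub>0) \<and>
          (\<forall>r\<in>{1..t}. X r \<omega> = X r \<omega>\<^sub>0 \<and> Y r \<omega> = Y r \<omega>\<^sub>0 \<and> Z r \<omega> = Z r \<omega>\<^sub>0 \<and> Q r \<omega> = Q r \<omega>\<^sub>0)) =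
        selection_prob (acl_graph G0 (\<lambda>r. Q r \<omega>\<^sub>0) (\<lambda>r. S r \<omega>\<^sub>0) (t - 1))
          (X t \<omega>\<^sub>0) (Y t \<omega>\<^sub>0) (Z t \<omega>\<^sub>0) s"

end

theory Submission
  imports Defs
begin

text \<open>
  Measure the depth of a vertex by its current distance to the initial graph; depths never
  increase.  Both endpoints of a new arc are equal or adjacent to a common sampled vertex (for a
  loop, a sampled neighbour of the new vertex), and a sampled vertex is an endpoint of a uniformly
  random existing arc.  So the largest depth on a new arc is at most one more than that on a
  uniformly random existing arc.  Hence, if \<open>\<Phi>\<close> is
  the sum of \<open>exp\<close> of the depth over all arcs, the expected value of \<open>\<Phi>\<close> grows at time
  \<open>t + 1\<close> at most by the factor \<open>1 + e u / (1 + l t)\<close>, and \<open>E \<Phi> \<le> K exp (e A)\<close> at time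
  \<open>n\<close> with \<open>A = (u / l) log n + 2 u\<close>.  By Markov's inequality all depths are at most
  \<open>2 e A\<close> except with probability \<open>K exp (- e A) \<le> K / n\<close>, and the diameter is at most
  twice the maximal depth plus the diameter of the initial graph.
\<close>

section \<open>Depth and potential\<close>

lemma sym_parcs: "(u, v) \<in> parcs (mk_symmetric G) \<Longrightarrow> (v, u) \<in> parcs (mk_symmetric G)"
  by (auto simp: parcs_mk_symmetric)

lemma sym_parcs_relpow:
  "(u, v) \<in> parcs (mk_symmetric G) ^^ k \<Longrightarrow> (v, u) \<in> parcs (mk_symmetric G) ^^ k"
proof (induction k arbitrary: v)
  case (Suc k)
  then obtain w where "(u, w) \<in> parcs (mk_symmetric G) ^^ k" "(w, v) \<in> parcs (mk_symmetric G)"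
    by auto
  with Suc.IH sym_parcs have "(v, w) \<in> parcs (mk_symmetric G)" "(w, u) \<in> parcs (mk_symmetric G) ^^ k"
    by auto
  then show ?case by (rule relpow_Suc_I2)
qed auto

lemma relpow_mono_base:
  fixes R R' :: "('a \<times> 'a) set"
  shows "R \<subseteq> R' \<Longrightarrow> (u, v) \<in> R ^^ k \<Longrightarrow> (u, v) \<in> R' ^^ k"
proof (induction k arbitrary: v)
  case (Suc k)
  from Suc.prems(2) obtain w where "(u, w) \<in> R ^^ k" "(w, v) \<in> R" by auto
  with Suc.IH Suc.prems(1) show ?case by auto
qed auto

text \<open>Distances are infima over paths, whereas powers of the arc relation only give walks.
  Cutting the cycles out of a walk yields a path; with unit costs no cycle is negative, so the
  length does not grow.\<close>

lemma undirected_dist_le: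
  assumes "wf_digraph G" "u \<in> verts G" "(u, v) \<in> parcs (mk_symmetric G) ^^ k"
  shows "undirected_dist G u v \<le> ereal (real k)"
proof -
  interpret G: wf_digraph G by fact
  interpret S: pair_wf_digraph "mk_symmetric G" by (rule G.wellformed_mk_symmetric)
  have "\<exists>p. S.awalk u p v \<and> length p = k"
    using assms(3)
  proof (induction k arbitrary: v)
    case 0
    then show ?case using assms(2) by (auto simp: S.awalk_Nil_iff)
  next
    case (Suc k)
    then obtain w where w: "(u, w) \<in> parcs (mk_symmetric G) ^^ k" "(w, v) \<in> parcs (mk_symmetric G)"
      by auto
    with Suc.IH obtain p where p: "S.awalk u p w" "length p = k" by blast
    have "S.awalk w [(w, v)] v"
      using w(2) S.arc_fst_in_verts S.arc_snd_in_verts by (fastforce simp: S.awalk_Cons_iff S.awalk_Nil_iff)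
    with p have "S.awalk u (p @ [(w, v)]) v" by (blast intro: S.awalk_appendI)
    with p(2) show ?case by (intro exI[of _ "p @ [(w, v)]"]) simp
  qed
  then obtain p where p: "S.awalk u p v" "length p = k" by blast
  have cost: "S.awalk_cost (\<lambda>_. 1) q = real (length q)" for q :: "('a \<times> 'a) list"
    by (induction q) (auto simp: S.awalk_cost_Nil S.awalk_cost_Cons)
  have "S.apath u (S.awalk_to_apath p) v" using p(1) by (rule S.apath_awalk_to_apath)
  moreover have "length (S.awalk_to_apath p) \<le> k"
    using S.awalk_to_path_no_neg_cyc_cost[OF p(1), of "\<lambda>_. 1"] p(2) by (simp add: cost)
  ultimately show ?thesis
    unfolding undirected_dist_def by (intro INF_lower2[of "S.awalk_to_apath p"]) auto
qed

lemma card_pair_le: "card {x, y} \<le> 2"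
  by (cases "x = y") auto

text \<open>A chain in a finite relation can be shortened to at most as many steps as the relation
  has pairs, and each arc yields at most two pairs. Applied to the initial graph, the bound goes
  into the additive constant of the theorem.\<close>

lemma connected_relpow:
  assumes "fin_digraph G" "Digraph_Component.connected G" "u \<in> verts G" "v \<in> verts G"
  shows "\<exists>k \<le> 2 * card (arcs G). (u, v) \<in> parcs (mk_symmetric G) ^^ k"
proof -
  interpret fin_digraph G by fact
  interpret S: pair_fin_digraph "mk_symmetric G" by (rule pair_fin_digraph_mk_symmetric)
  have "u \<rightarrow>\<^sup>*\<^bsub>mk_symmetric G\<^esub> v"
    using assms by (auto simp: connected_def strongly_connected_def)
  then have "(u, v) \<in> (parcs (mk_symmetric G))\<^sup>*"
    by (simp add: reachable_def rtrancl_on_rtranclI)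
  then obtain k where k: "k \<le> card (parcs (mk_symmetric G))" "(u, v) \<in> parcs (mk_symmetric G) ^^ k"
    using rtrancl_finite_eq_relpow[of "parcs (mk_symmetric G)"] by auto
  have "card (parcs (mk_symmetric G)) \<le> (\<Sum>e\<in>arcs G. card {(tail G e, head G e), (head G e, tail G e)})"
    unfolding parcs_mk_symmetric by (rule card_UN_le) simp
  also have "\<dots> \<le> (\<Sum>e\<in>arcs G. 2)"
    by (intro sum_mono) (rule card_pair_le)
  finally have "card (parcs (mk_symmetric G)) \<le> 2 * card (arcs G)" by simp
  with k show ?thesis by (meson le_trans)
qed

section \<open>Depth relative to the initial graph\<close>

definition reached :: "('v vtx, 'e) pre_digraph \<Rightarrow> 'v vtx \<Rightarrow> bool" where
  "reached G v \<longleftrightarrow> (\<exists>k r. (Inl r, v) \<in> parcs (mk_symmetric G) ^^ k)"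

text \<open>Junk value for vertices in components that contain no vertex of the initial graph, cf. \<open>reached\<close>.\<close>

definition depth :: "('v vtx, 'e) pre_digraph \<Rightarrow> 'v vtx \<Rightarrow> nat" where
  "depth G v = (LEAST k. \<exists>r. (Inl r, v) \<in> parcs (mk_symmetric G) ^^ k)"

lemma depth_walk: "reached G v \<Longrightarrow> \<exists>r. (Inl r, v) \<in> parcs (mk_symmetric G) ^^ depth G v"
  unfolding depth_def reached_def by (rule LeastI_ex)

lemma depth_le: "(Inl r, v) \<in> parcs (mk_symmetric G) ^^ k \<Longrightarrow> depth G v \<le> k"
  unfolding depth_def by (blast intro: Least_le)

text \<open>The zeroth power of a relation is the identity on the whole type, so a root need not be
  a vertex of \<open>G\<close>. This is repaired in \<open>digraph_diameter_le\<close>.\<close>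

lemma reached_Inl [simp]: "reached G (Inl r)"
  unfolding reached_def by (rule exI[of _ 0]) simp

lemma depth_Inl [simp]: "depth G (Inl r) = 0"
  using depth_le[of r "Inl r" 0 G] by simp

lemma depth_step:
  assumes "reached G u" "(u, v) \<in> parcs (mk_symmetric G)"
  shows "reached G v" "depth G v \<le> Suc (depth G u)"
proof -
  obtain r where "(Inl r, u) \<in> parcs (mk_symmetric G) ^^ depth G u" using depth_walk[OF assms(1)] ..
  with assms(2) have *: "(Inl r, v) \<in> parcs (mk_symmetric G) ^^ Suc (depth G u)" by auto
  then show "reached G v" unfolding reached_def by blast
  from * show "depth G v \<le> Suc (depth G u)" by (rule depth_le)
qed

text \<open>More arcs give more walks, so distances can only shrink. Without
  \<open>reached G v\<close> the value \<open>depth G v\<close> would be arbitrary.\<close>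

lemma depth_mono:
  assumes "parcs (mk_symmetric G) \<subseteq> parcs (mk_symmetric G')" "reached G v"
  shows "reached G' v" "depth G' v \<le> depth G v"
proof -
  obtain r where "(Inl r, v) \<in> parcs (mk_symmetric G) ^^ depth G v" using depth_walk[OF assms(2)] ..
  with assms(1) have *: "(Inl r, v) \<in> parcs (mk_symmetric G') ^^ depth G v" by (rule relpow_mono_base)
  then show "reached G' v" unfolding reached_def by blast
  from * show "depth G' v \<le> depth G v" by (rule depth_le)
qed

text \<open>The maximum dominates both ends, so one potential controls samples from
  \<open>rho_out\<close> (tails of uniform arcs) and from \<open>rho_in\<close> (heads)
  alike.\<close>

definition arc_depth :: "('v vtx, 'e) pre_digraph \<Rightarrow> 'e \<Rightarrow> nat" where
  "arc_depth G a = max (depth G (tail G a)) (depth G (head G a))"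

definition potential :: "('v vtx, 'e) pre_digraph \<Rightarrow> real" where
  "potential G = (\<Sum>a\<in>arcs G. exp (real (arc_depth G a)))"

text \<open>The \<open>q\<close> loops at the new vertex are charged to a single sampled neighbour of it; \<open>hd\<close> is
  applied only to nonempty lists, since \<open>X + Y > 0\<close>.\<close>

fun selection_cost :: "('v vtx, 'e) pre_digraph \<Rightarrow> nat \<Rightarrow> 'v vtx selection \<Rightarrow> real" where
  "selection_cost G q (xs, ys, ws, ws') =
     (\<Sum>x\<leftarrow>xs. exp (real (depth G x))) + (\<Sum>y\<leftarrow>ys. exp (real (depth G y))) +
     (\<Sum>w\<leftarrow>ws. exp (real (depth G w))) + real q * exp (real (depth G (hd (xs @ ys))))"

text \<open>Contains the support of \<open>selection_prob\<close>, see
  \<open>selection_prob_eq_0\<close>; the growth step is analysed only for such selections.\<close>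

fun selection_ok :: "('v, 'e) pre_digraph \<Rightarrow> nat \<Rightarrow> nat \<Rightarrow> nat \<Rightarrow> 'v selection \<Rightarrow> bool" where
  "selection_ok G a b c (xs, ys, ws, ws') \<longleftrightarrow>
     length xs = a \<and> length ys = b \<and> length ws = c \<and> length ws' = c \<and>
     set xs \<subseteq> verts G \<and> set ys \<subseteq> verts G \<and> set ws \<subseteq> verts G \<and> set ws' \<subseteq> verts G"

text \<open>The invariant of the growth. The copy of the initial graph lets walks between roots pass
  through it, the bound on the time stamps makes the names of new arcs fresh, and the last clause
  ensures that the depth of each later vertex is seen by the potential, a sum over arcs.\<close>

definition process_graph ::
  "('v, 'e) pre_digraph \<Rightarrow> nat \<Rightarrow> ('v vtx, 'e edg) pre_digraph \<Rightarrow> bool"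
where
  "process_graph G0 t G \<longleftrightarrow> fin_digraph G \<and> {r. Inl r \<in> verts G} = verts G0 \<and>
     parcs (mk_symmetric (initial_graph G0)) \<subseteq> parcs (mk_symmetric G) \<and>
     (\<forall>v\<in>verts G. reached G v) \<and>
     (\<forall>r i. Inr (r, i) \<in> arcs G \<longrightarrow> r \<le> t) \<and>
     (\<forall>s. Inr s \<in> verts G \<longrightarrow> (\<exists>a\<in>arcs G. tail G a = Inr s \<or> head G a = Inr s))"

section \<open>Effect of one growth step on the invariant and the potential\<close>

lemma initial_graph_simps [simp]:
  "verts (initial_graph G0) = Inl ` verts G0"
  "arcs (initial_graph G0) = Inl ` arcs G0"
  "tail (initial_graph G0) (Inl e) = Inl (tail G0 e)"
  "head (initial_graph G0) (Inl e) = Inl (head G0 e)"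
  by (simp_all add: initial_graph_def)

lemma process_graph_initial:
  assumes "fin_digraph G0"
  shows "process_graph G0 0 (initial_graph G0)"
proof -
  interpret fin_digraph G0 by fact
  have "fin_digraph (initial_graph G0)"
    by unfold_locales auto
  then show ?thesis unfolding process_graph_def by auto
qed

lemma potential_initial: "potential (initial_graph G0) = real (card (arcs G0))"
  unfolding potential_def arc_depth_def by (simp add: sum.reindex)

lemma sum_list_le_mult:
  fixes f g :: "'a \<Rightarrow> real"
  assumes "\<And>x. x \<in> set xs \<Longrightarrow> f x \<le> c * g x"
  shows "(\<Sum>x\<leftarrow>xs. f x) \<le> c * (\<Sum>x\<leftarrow>xs. g x)"
  using assms sum_list_mono[of xs f "\<lambda>x. c * g x"] by (simp add: sum_list_const_mult)

lemma sum_list_zip_le_mult: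
  fixes g :: "'a \<Rightarrow> real"
  assumes "length ws = length ws'" "\<And>w w'. (w, w') \<in> set (zip ws ws') \<Longrightarrow> f (w, w') \<le> c * g w"
  shows "(\<Sum>e\<leftarrow>zip ws ws'. f e) \<le> c * (\<Sum>w\<leftarrow>ws. g w)"
  using assms by (induction ws ws' rule: list_induct2) (auto simp: distrib_left intro!: add_mono)

text \<open>Arcs of \<open>G\<close> carry time stamps at most \<open>t\<close>, so the arcs stamped
  \<open>Suc t\<close> are new and \<open>grow\<close> leaves the ends of the old ones
  unchanged.\<close>

lemma grow_simps:
  assumes "process_graph G0 t G"
    and "G' = grow (Suc t) q s G" "L = new_edges (Inr (Suc t)) q s"
  shows "verts G' = insert (Inr (Suc t)) (verts G)"
    and "arcs G' = arcs G \<union> (\<lambda>i. Inr (Suc t, i)) ` {..<length L}"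
    and "arcs G \<inter> (\<lambda>i. Inr (Suc t, i)) ` {..<length L} = {}"
    and "\<And>a. a \<in> arcs G \<Longrightarrow> tail G' a = tail G a"
    and "\<And>a. a \<in> arcs G \<Longrightarrow> head G' a = head G a"
    and "\<And>i. tail G' (Inr (Suc t, i)) = fst (L ! i)"
    and "\<And>i. head G' (Inr (Suc t, i)) = snd (L ! i)"
proof -
  have t: "Inr (r, i) \<in> arcs G \<Longrightarrow> r \<noteq> Suc t" for r i
    using assms(1) unfolding process_graph_def by force
  show "verts G' = insert (Inr (Suc t)) (verts G)"
    and "arcs G' = arcs G \<union> (\<lambda>i. Inr (Suc t, i)) ` {..<length L}"
    and "\<And>i. tail G' (Inr (Suc t, i)) = fst (L ! i)"
    and "\<And>i. head G' (Inr (Suc t, i)) = snd (L ! i)"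
    using assms(2,3) by (auto simp: grow_def Let_def)
  show "arcs G \<inter> (\<lambda>i. Inr (Suc t, i)) ` {..<length L} = {}"
    using t by auto
  fix a assume "a \<in> arcs G"
  then show "tail G' a = tail G a" "head G' a = head G a"
    using assms(2) t by (auto simp: grow_def Let_def split: sum.splits)
qed

text \<open>The deterministic half of the argument, for one fixed selection. The condition
  \<open>a + b > 0\<close> joins the new vertex to an old one, which keeps every vertex within reach
  of the initial graph.\<close>

lemma grow_step:
  assumes G: "process_graph G0 t G" and sel: "selection_ok G a b c s" and ab: "a + b > 0"
  shows "process_graph G0 (Suc t) (grow (Suc t) q s G)"
    and "card (arcs (grow (Suc t) q s G)) = card (arcs G) + (a + b + c + q)"
    and "potential (grow (Suc t) q s G) \<le> potential G + exp 1 * selection_cost G q s"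
proof -
  obtain xs ys ws ws' where s: "s = (xs, ys, ws, ws')" by (metis prod_cases4)
  define v :: "'a vtx" where "v = Inr (Suc t)"
  define L where "L = new_edges v q s"
  define G' where "G' = grow (Suc t) q s G"
  note gs = grow_simps[OF G G'_def L_def[unfolded v_def]]
  interpret fin_digraph G using G by (simp add: process_graph_def)
  have reached_G: "reached G w" if "w \<in> verts G" for w
    using G that by (simp add: process_graph_def)
  have len: "length xs = a" "length ys = b" "length ws = c" "length ws' = c"
    and sub: "set xs \<subseteq> verts G" "set ys \<subseteq> verts G" "set ws \<subseteq> verts G" "set ws' \<subseteq> verts G"
    using sel by (auto simp: s)
  have L: "L = zip ws ws' @ map (\<lambda>x. (x, v)) xs @ map (\<lambda>y. (v, y)) ys @ replicate q (v, v)"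
    by (simp add: L_def s)
  have Lverts: "x \<in> verts G' \<and> y \<in> verts G'" if "(x, y) \<in> set L" for x y
    using that sub unfolding L gs(1) v_def by (auto dest: set_zip_leftD set_zip_rightD)
  have L_arc: "\<exists>e\<in>arcs G'. tail G' e = x \<and> head G' e = y" if xy: "(x, y) \<in> set L" for x y
  proof -
    from xy obtain i where "i < length L" "L ! i = (x, y)" by (auto simp: in_set_conv_nth)
    then show ?thesis
      using gs(2,6,7) by (intro bexI[of _ "Inr (Suc t, i)"]) auto
  qed
  have fin: "fin_digraph G'"
  proof
    fix e assume "e \<in> arcs G'"
    then consider "e \<in> arcs G" | i where "i < length L" "e = Inr (Suc t, i)" using gs(2) by auto
    then have "tail G' e \<in> verts G' \<and> head G' e \<in> verts G'"
    proof cases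
      case 1
      then show ?thesis by (simp add: gs(1,4,5))
    next
      case 2
      then show ?thesis using Lverts[of "fst (L ! i)" "snd (L ! i)"] by (simp add: gs(6,7))
    qed
    then show "tail G' e \<in> verts G'" "head G' e \<in> verts G'" by auto
  qed (simp_all add: gs(1,2))
  have sub_parcs: "parcs (mk_symmetric G) \<subseteq> parcs (mk_symmetric G')"
    using gs(2,4,5) by (auto simp: parcs_mk_symmetric)
  have L_parcs: "(x, y) \<in> parcs (mk_symmetric G')" "(y, x) \<in> parcs (mk_symmetric G')"
    if "(x, y) \<in> set L" for x y
    using L_arc[OF that] by (auto simp: parcs_mk_symmetric)
  have old: "reached G' w" "depth G' w \<le> depth G w" if "w \<in> verts G" for w
    using depth_mono[OF sub_parcs reached_G[OF that]] by auto
  have nb: "reached G' z" "depth G' z \<le> Suc (depth G w)"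
    if "w \<in> verts G" "(w, z) \<in> parcs (mk_symmetric G')" for w z
    using depth_step[OF old(1)[OF that(1)] that(2)] old(2)[OF that(1)] by auto
  \<comment> \<open>This old neighbour of the new vertex bounds its depth and is charged for all
    \<open>q\<close> loops.\<close>
  define p where "p = hd (xs @ ys)"
  have ne: "xs @ ys \<noteq> []" using ab len by auto
  then have "p \<in> set xs \<union> set ys" unfolding p_def using hd_in_set[OF ne] by simp
  then have p: "p \<in> verts G" "(p, v) \<in> set L \<or> (v, p) \<in> set L" using sub by (auto simp: L)
  have pv: "(p, v) \<in> parcs (mk_symmetric G')" using p(2) L_parcs by blast
  have arc: "\<exists>e\<in>arcs G'. tail G' e = v \<or> head G' e = v"
    using p(2) L_arc by blast
  show "process_graph G0 (Suc t) (grow (Suc t) q s G)"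
    unfolding process_graph_def G'_def[symmetric]
  proof (intro conjI)
    show "{r. Inl r \<in> verts G'} = verts G0" using G by (auto simp: gs(1) process_graph_def)
    show "parcs (mk_symmetric (initial_graph G0)) \<subseteq> parcs (mk_symmetric G')"
      using G sub_parcs by (auto simp: process_graph_def)
    show "\<forall>v\<in>verts G'. reached G' v" using old(1) nb(1)[OF p(1) pv] by (auto simp: gs(1) v_def)
    show "\<forall>r i. Inr (r, i) \<in> arcs G' \<longrightarrow> r \<le> Suc t"
      using G by (auto simp: gs(2) process_graph_def le_SucI)
    show "\<forall>s. Inr s \<in> verts G' \<longrightarrow> (\<exists>a\<in>arcs G'. tail G' a = Inr s \<or> head G' a = Inr s)"
    proof (intro allI impI)
      fix r assume "Inr r \<in> verts G'"
      then consider "Inr r = v" | "Inr r \<in> verts G" by (auto simp: gs(1) v_def)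
      then show "\<exists>a\<in>arcs G'. tail G' a = Inr r \<or> head G' a = Inr r"
      proof cases
        case 2
        then obtain e where "e \<in> arcs G" "tail G e = Inr r \<or> head G e = Inr r"
          using G by (auto simp: process_graph_def)
        then show ?thesis using gs(2,4,5) by (intro bexI[of _ e]) auto
      qed (use arc in auto)
    qed
  qed (fact fin)
  have inj: "inj_on (\<lambda>i. Inr (Suc t, i) :: 'b edg) {..<length L}" by (auto simp: inj_on_def)
  show "card (arcs (grow (Suc t) q s G)) = card (arcs G) + (a + b + c + q)"
    unfolding G'_def[symmetric] gs(2) using gs(3) inj len
    by (subst card_Un_disjoint) (auto simp: card_image L)
  define h :: "'a vtx \<times> 'a vtx \<Rightarrow> real"
    where "h = (\<lambda>(x, y). exp (real (max (depth G' x) (depth G' y))))"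
  \<comment> \<open>Here \<open>w\<close> is the sampled vertex charged for the arc
    \<open>(x, y)\<close>: its tail for an arc between sampled vertices, the old end for an arc at
    \<open>v\<close>, and \<open>p\<close> for a loop. Both ends are at most one step away from
    \<open>w\<close>, which costs the factor \<open>exp 1\<close>.\<close>
  have h: "h (x, y) \<le> exp 1 * exp (real (depth G w))"
    if "w \<in> verts G" "(x = w \<or> (w, x) \<in> parcs (mk_symmetric G')) \<and> (y = w \<or> (w, y) \<in> parcs (mk_symmetric G'))"
    for x y w
  proof -
    have "depth G' x \<le> Suc (depth G w)" "depth G' y \<le> Suc (depth G w)"
      using that old(2)[OF that(1)] nb(2)[OF that(1)] by (auto intro: le_SucI)
    then have "real (max (depth G' x) (depth G' y)) \<le> 1 + real (depth G w)"
      by linarith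
    then have "exp (real (max (depth G' x) (depth G' y))) \<le> exp (1 + real (depth G w))"
      by (simp only: exp_le_cancel_iff)
    then show ?thesis unfolding h_def prod.case exp_add .
  qed
  have "potential G' = (\<Sum>e\<in>arcs G. exp (real (arc_depth G' e))) + (\<Sum>i<length L. h (L ! i))"
    unfolding potential_def gs(2) using gs(3) inj
    by (subst sum.union_disjoint)
       (auto simp: sum.reindex h_def arc_depth_def gs(6,7) case_prod_beta)
  also have "(\<Sum>i<length L. h (L ! i)) = (\<Sum>e\<leftarrow>L. h e)"
    by (simp add: sum_list_sum_nth atLeast0LessThan)
  also have "\<dots> = (\<Sum>e\<leftarrow>zip ws ws'. h e) + (\<Sum>x\<leftarrow>xs. h (x, v)) + (\<Sum>y\<leftarrow>ys. h (v, y)) + real q * h (v, v)"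
    by (simp add: L comp_def sum_list_replicate)
  also have "\<dots> \<le> exp 1 * (\<Sum>w\<leftarrow>ws. exp (real (depth G w))) + exp 1 * (\<Sum>x\<leftarrow>xs. exp (real (depth G x)))
      + exp 1 * (\<Sum>y\<leftarrow>ys. exp (real (depth G y))) + real q * (exp 1 * exp (real (depth G p)))"
  proof (intro add_mono)
    show "(\<Sum>e\<leftarrow>zip ws ws'. h e) \<le> exp 1 * (\<Sum>w\<leftarrow>ws. exp (real (depth G w)))"
    proof (rule sum_list_zip_le_mult)
      fix w w' assume "(w, w') \<in> set (zip ws ws')"
      then have "w \<in> verts G" "(w, w') \<in> set L" using sub by (auto simp: L dest: set_zip_leftD)
      then show "h (w, w') \<le> exp 1 * exp (real (depth G w))"
        using h[of w w w'] L_parcs[of w w'] by blast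
    qed (simp add: len)
    show "(\<Sum>x\<leftarrow>xs. h (x, v)) \<le> exp 1 * (\<Sum>x\<leftarrow>xs. exp (real (depth G x)))"
    proof (rule sum_list_le_mult)
      fix x assume "x \<in> set xs"
      then have "x \<in> verts G" "(x, v) \<in> set L" using sub by (auto simp: L)
      then show "h (x, v) \<le> exp 1 * exp (real (depth G x))"
        using h[of x x v] L_parcs[of x v] by blast
    qed
    show "(\<Sum>y\<leftarrow>ys. h (v, y)) \<le> exp 1 * (\<Sum>y\<leftarrow>ys. exp (real (depth G y)))"
    proof (rule sum_list_le_mult)
      fix y assume "y \<in> set ys"
      then have "y \<in> verts G" "(v, y) \<in> set L" using sub by (auto simp: L)
      then show "h (v, y) \<le> exp 1 * exp (real (depth G y))"
        using h[of y v y] L_parcs[of v y] by blast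
    qed
    show "real q * h (v, v) \<le> real q * (exp 1 * exp (real (depth G p)))"
      using h[OF p(1), of v v] pv by (intro mult_left_mono) auto
  qed
  also have "\<dots> = exp 1 * selection_cost G q s"
    by (simp add: s p_def algebra_simps)
  also have "(\<Sum>e\<in>arcs G. exp (real (arc_depth G' e))) \<le> potential G"
    unfolding potential_def
  proof (intro sum_mono)
    fix e assume "e \<in> arcs G"
    then show "exp (real (arc_depth G' e)) \<le> exp (real (arc_depth G e))"
      using old(2)[OF tail_in_verts, of e] old(2)[OF head_in_verts, of e] by (auto simp: arc_depth_def gs(4,5))
  qed
  finally show "potential (grow (Suc t) q s G) \<le> potential G + exp 1 * selection_cost G q s"
    by (simp add: G'_def)
qed

text \<open>A later vertex has an incident arc by the invariant. An initial vertex has depth 0, so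
  any arc serves.\<close>

lemma exp_depth_le_potential:
  assumes "process_graph G0 t G" "v \<in> verts G" "arcs G \<noteq> {}"
  shows "exp (real (depth G v)) \<le> potential G"
proof -
  interpret fin_digraph G using assms by (simp add: process_graph_def)
  obtain a where a: "a \<in> arcs G" "depth G v \<le> arc_depth G a"
  proof (cases v)
    case (Inl r)
    then show ?thesis using assms(3) that by auto
  next
    case (Inr s)
    with assms(1,2) obtain a where "a \<in> arcs G" "tail G a = v \<or> head G a = v"
      by (auto simp: process_graph_def)
    then show ?thesis using that[of a] by (auto simp: arc_depth_def)
  qed
  then have "exp (real (depth G v)) \<le> exp (real (arc_depth G a))" by simp
  also have "\<dots> \<le> potential G" unfolding potential_def using a(1)
    by (intro member_le_sum) auto
  finally show ?thesis .
qed

section \<open>From depths to the diameter\<close>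

lemma relpow_image_Inl:
  "(u, v) \<in> parcs (mk_symmetric G0) ^^ k \<Longrightarrow> (Inl u, Inl v) \<in> parcs (mk_symmetric (initial_graph G0)) ^^ k"
proof (induction k arbitrary: v)
  case (Suc k)
  then obtain w where "(u, w) \<in> parcs (mk_symmetric G0) ^^ k" "(w, v) \<in> parcs (mk_symmetric G0)"
    by auto
  moreover from this(2) have "(Inl w, Inl v) \<in> parcs (mk_symmetric (initial_graph G0))"
    by (auto simp: parcs_mk_symmetric)
  ultimately show ?case using Suc.IH by auto
qed auto

text \<open>Walk from \<open>u\<close> to a root, through the initial graph to a root of
  \<open>v\<close>, and on to \<open>v\<close>. The middle piece has length at most
  \<open>2 * card (arcs G0)\<close>.\<close>

lemma digraph_diameter_le:
  assumes G: "process_graph G0 t G" and G0: "fin_digraph G0" "Digraph_Component.connected G0"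
    and D: "\<And>v. v \<in> verts G \<Longrightarrow> real (depth G v) \<le> D"
  shows "digraph_diameter G \<le> ereal (2 * D + 2 * real (card (arcs G0)))"
  unfolding digraph_diameter_def
proof (intro SUP_least)
  interpret fin_digraph G using G by (simp add: process_graph_def)
  interpret S: pair_wf_digraph "mk_symmetric G" by (rule wellformed_mk_symmetric)
  \<comment> \<open>A root that starts a walk of positive length is an end of an arc, hence a vertex
    of \<open>G\<close>; for length 0 the root is \<open>v\<close> itself.\<close>
  have root: "\<exists>r\<in>verts G0. (Inl r, v) \<in> parcs (mk_symmetric G) ^^ depth G v" if v: "v \<in> verts G" for v
  proof -
    obtain r where r: "(Inl r, v) \<in> parcs (mk_symmetric G) ^^ depth G v"
      using depth_walk G v by (fastforce simp: process_graph_def)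
    have "Inl r \<in> verts G"
    proof (cases "depth G v")
      case 0
      with r v show ?thesis by simp
    next
      case (Suc k)
      with r obtain w where "(Inl r, w) \<in> parcs (mk_symmetric G)" by (metis relpow_Suc_E2)
      then show ?thesis using S.arc_fst_in_verts by fastforce
    qed
    with r G show ?thesis by (auto simp: process_graph_def)
  qed
  fix u v assume uv: "u \<in> verts G" "v \<in> verts G"
  obtain r r' where r: "r \<in> verts G0" "(Inl r, u) \<in> parcs (mk_symmetric G) ^^ depth G u"
    "r' \<in> verts G0" "(Inl r', v) \<in> parcs (mk_symmetric G) ^^ depth G v"
    using root uv by blast
  obtain k where k: "k \<le> 2 * card (arcs G0)" "(r, r') \<in> parcs (mk_symmetric G0) ^^ k"
    using connected_relpow[OF G0] r by blast
  have "(Inl r, Inl r') \<in> parcs (mk_symmetric G) ^^ k"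
    using relpow_mono_base[OF _ relpow_image_Inl[OF k(2)]] G by (auto simp: process_graph_def)
  then have "(u, v) \<in> parcs (mk_symmetric G) ^^ (depth G u + k + depth G v)"
    using sym_parcs_relpow[OF r(2)] r(4) by (auto simp: relpow_add)
  then have "undirected_dist G u v \<le> ereal (real (depth G u + k + depth G v))"
    by (intro undirected_dist_le wf_digraph uv)
  also have "\<dots> \<le> ereal (2 * D + 2 * real (card (arcs G0)))"
    using D[OF uv(1)] D[OF uv(2)] k(1) by simp
  finally show "undirected_dist G u v \<le> ereal (2 * D + 2 * real (card (arcs G0)))" .
qed

section \<open>The expected cost of a selection\<close>

abbreviation lists_of_length :: "'a set \<Rightarrow> nat \<Rightarrow> 'a list set" where
  "lists_of_length V n \<equiv> {xs. set xs \<subseteq> V \<and> length xs = n}"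

lemma sum_lists_Suc:
  fixes g :: "'a list \<Rightarrow> real"
  shows "(\<Sum>xs\<in>lists_of_length V (Suc n). g xs) = (\<Sum>x\<in>V. \<Sum>xs\<in>lists_of_length V n. g (x # xs))"
proof -
  have "(\<Sum>xs\<in>lists_of_length V (Suc n). g xs) = (\<Sum>(xs, x)\<in>lists_of_length V n \<times> V. g (x # xs))"
    unfolding lists_length_Suc_eq by (subst sum.reindex) (auto simp: inj_on_def case_prod_beta comp_def)
  also have "\<dots> = (\<Sum>xs\<in>lists_of_length V n. \<Sum>x\<in>V. g (x # xs))"
    by (rule sum.cartesian_product[symmetric])
  finally show ?thesis by (simp only: sum.swap[of _ V])
qed

lemma sum_prod_list:
  fixes p :: "'a \<Rightarrow> real"
  shows "(\<Sum>xs\<in>lists_of_length V n. prod_list (map p xs)) = sum p V ^ n"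
proof (induction n)
  case 0
  have "lists_of_length V 0 = {[]}" by auto
  then show ?case by simp
next
  case (Suc n)
  then show ?case by (simp only: sum_lists_Suc list.map prod_list.Cons sum_distrib_left[symmetric]
    sum_distrib_right[symmetric] power_Suc)
qed

text \<open>The first sample has law \<open>p\<close> and the others integrate to 1. This handles
  the loops, which are charged to the head of a list.\<close>

lemma sum_prod_list_hd:
  fixes p f :: "'a \<Rightarrow> real"
  assumes "sum p V = 1" "n > 0"
  shows "(\<Sum>xs\<in>lists_of_length V n. prod_list (map p xs) * f (hd xs)) = (\<Sum>v\<in>V. p v * f v)"
proof -
  obtain m where n: "n = Suc m" using assms(2) by (cases n) auto
  have "(\<Sum>xs\<in>lists_of_length V n. prod_list (map p xs) * f (hd xs)) =
      (\<Sum>x\<in>V. (p x * f x) * (\<Sum>xs\<in>lists_of_length V m. prod_list (map p xs)))"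
    unfolding n sum_lists_Suc sum_distrib_left by (simp add: ac_simps)
  then show ?thesis by (simp add: sum_prod_list assms(1))
qed

text \<open>Linearity of expectation: split off the first sample and use that each factor has total
  mass 1.\<close>

lemma sum_prod_list_sum_list:
  fixes p f :: "'a \<Rightarrow> real"
  assumes "sum p V = 1"
  shows "(\<Sum>xs\<in>lists_of_length V n. prod_list (map p xs) * (\<Sum>x\<leftarrow>xs. f x)) = real n * (\<Sum>v\<in>V. p v * f v)"
proof (induction n)
  case 0
  have "lists_of_length V 0 = {[]}" by auto
  then show ?case by simp
next
  case (Suc n)
  let ?P = "\<lambda>xs. prod_list (map p xs)"
  have "(\<Sum>xs\<in>lists_of_length V (Suc n). ?P xs * (\<Sum>x\<leftarrow>xs. f x)) =
      (\<Sum>x\<in>V. \<Sum>xs\<in>lists_of_length V n. (p x * f x) * ?P xs + p x * (?P xs * (\<Sum>x\<leftarrow>xs. f x)))"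
    unfolding sum_lists_Suc by (intro sum.cong refl) (simp add: algebra_simps)
  also have "\<dots> = (\<Sum>x\<in>V. p x * f x) * (\<Sum>xs\<in>lists_of_length V n. ?P xs)
      + sum p V * (\<Sum>xs\<in>lists_of_length V n. ?P xs * (\<Sum>x\<leftarrow>xs. f x))"
    by (simp only: sum.distrib sum_distrib_left[symmetric] sum_distrib_right[symmetric])
  also have "\<dots> = (\<Sum>x\<in>V. p x * f x) + real n * (\<Sum>x\<in>V. p x * f x)"
    by (simp add: sum_prod_list assms Suc.IH)
  finally show ?case by (simp add: algebra_simps)
qed

text \<open>Under a product of probability weights each summand sees only its own marginal. The
  fourth factor, to be the law of the list \<open>ws'\<close>, enters through its mass alone because
  no cost is charged to that list.\<close>

lemma sum_product_weights:
  fixes f p :: "'a \<Rightarrow> real" and g q :: "'b \<Rightarrow> real" and h r :: "'c \<Rightarrow> real" and s :: "'d \<Rightarrow> real"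
  assumes "sum p A = 1" "sum q B = 1" "sum r C = 1" "sum s D = 1"
  shows "(\<Sum>(x, y, z, w)\<in>A \<times> B \<times> C \<times> D. p x * q y * r z * s w * (f x + g y + h z)) =
    (\<Sum>x\<in>A. p x * f x) + (\<Sum>y\<in>B. q y * g y) + (\<Sum>z\<in>C. r z * h z)"
proof -
  have "(\<Sum>(x, y, z, w)\<in>A \<times> B \<times> C \<times> D. p x * q y * r z * s w * (f x + g y + h z)) =
      (\<Sum>x\<in>A. \<Sum>y\<in>B. \<Sum>z\<in>C. \<Sum>w\<in>D. p x * q y * r z * s w * (f x + g y + h z))"
    by (simp add: sum.cartesian_product)
  also have "\<dots> = (\<Sum>x\<in>A. \<Sum>y\<in>B. \<Sum>z\<in>C. p x * q y * r z * (f x + g y + h z))"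
  proof (intro sum.cong refl)
    fix x y z
    have "(\<Sum>w\<in>D. p x * q y * r z * s w * (f x + g y + h z)) = (\<Sum>w\<in>D. (p x * q y * r z * (f x + g y + h z)) * s w)"
      by (simp add: ac_simps)
    then show "(\<Sum>w\<in>D. p x * q y * r z * s w * (f x + g y + h z)) = p x * q y * r z * (f x + g y + h z)"
      by (simp add: sum_distrib_left[symmetric] assms(4))
  qed
  also have "\<dots> = (\<Sum>x\<in>A. \<Sum>y\<in>B. p x * q y * (f x + g y) + p x * q y * (\<Sum>z\<in>C. r z * h z))"
  proof (intro sum.cong refl)
    fix x y
    have "(\<Sum>z\<in>C. p x * q y * r z * (f x + g y + h z)) =
        (\<Sum>z\<in>C. (p x * q y * (f x + g y)) * r z + p x * q y * (r z * h z))"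
      by (simp add: algebra_simps)
    then show "(\<Sum>z\<in>C. p x * q y * r z * (f x + g y + h z)) =
        p x * q y * (f x + g y) + p x * q y * (\<Sum>z\<in>C. r z * h z)"
      by (simp add: sum.distrib sum_distrib_left[symmetric] assms(3))
  qed
  also have "\<dots> = (\<Sum>x\<in>A. p x * f x + p x * ((\<Sum>y\<in>B. q y * g y) + (\<Sum>z\<in>C. r z * h z)))"
  proof (intro sum.cong refl)
    fix x
    let ?Z = "\<Sum>z\<in>C. r z * h z"
    have "(\<Sum>y\<in>B. p x * q y * (f x + g y) + p x * q y * ?Z) =
        (\<Sum>y\<in>B. (p x * f x + p x * ?Z) * q y + p x * (q y * g y))"
      by (simp add: algebra_simps)
    then show "(\<Sum>y\<in>B. p x * q y * (f x + g y) + p x * q y * ?Z) =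
        p x * f x + p x * ((\<Sum>y\<in>B. q y * g y) + ?Z)"
      by (simp add: sum.distrib sum_distrib_left[symmetric] assms(2) distrib_left)
  qed
  also have "\<dots> = (\<Sum>x\<in>A. p x * f x) + (\<Sum>y\<in>B. q y * g y) + (\<Sum>z\<in>C. r z * h z)"
    by (simp add: sum.distrib sum_distrib_right[symmetric] assms(1))
  finally show ?thesis .
qed

section \<open>Degree-proportional sampling as the choice of an end of a uniform arc\<close>

lemma sum_degree_weighted:
  fixes f :: "'v \<Rightarrow> real"
  assumes "fin_digraph G"
  shows "(\<Sum>v\<in>verts G. real (out_degree G v) * f v) = (\<Sum>a\<in>arcs G. f (tail G a))"
    and "(\<Sum>v\<in>verts G. real (in_degree G v) * f v) = (\<Sum>a\<in>arcs G. f (head G a))"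
proof -
  interpret fin_digraph G by fact
  have "(\<Sum>a\<in>arcs G. f (tail G a)) = (\<Sum>v\<in>verts G. \<Sum>a\<in>{a \<in> arcs G. tail G a = v}. f (tail G a))"
    by (rule sum.group[symmetric]) auto
  also have "\<dots> = (\<Sum>v\<in>verts G. real (out_degree G v) * f v)"
    by (simp add: out_degree_def out_arcs_def)
  finally show "(\<Sum>v\<in>verts G. real (out_degree G v) * f v) = (\<Sum>a\<in>arcs G. f (tail G a))" ..
  have "(\<Sum>a\<in>arcs G. f (head G a)) = (\<Sum>v\<in>verts G. \<Sum>a\<in>{a \<in> arcs G. head G a = v}. f (head G a))"
    by (rule sum.group[symmetric]) auto
  also have "\<dots> = (\<Sum>v\<in>verts G. real (in_degree G v) * f v)"
    by (simp add: in_degree_def in_arcs_def)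
  finally show "(\<Sum>v\<in>verts G. real (in_degree G v) * f v) = (\<Sum>a\<in>arcs G. f (head G a))" ..
qed

text \<open>Counting arcs by their tails or by their heads turns the degree weights into a uniform
  average over arcs; the constant function identifies both normalising sums with the number of
  arcs.\<close>

lemma rho_sum:
  fixes f :: "'v \<Rightarrow> real"
  assumes "fin_digraph G"
  shows "(\<Sum>v\<in>verts G. rho_out G v * f v) = (\<Sum>a\<in>arcs G. f (tail G a)) / real (card (arcs G))"
    and "(\<Sum>v\<in>verts G. rho_in G v * f v) = (\<Sum>a\<in>arcs G. f (head G a)) / real (card (arcs G))"
  using sum_degree_weighted[OF assms, of "\<lambda>_. 1"]
  by (simp_all add: rho_out_def rho_in_def sum_degree_weighted[OF assms, of f, symmetric] sum_divide_distrib)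

lemma rho_sum_1:
  assumes "fin_digraph G" "arcs G \<noteq> {}"
  shows "sum (rho_out G) (verts G) = 1" "sum (rho_in G) (verts G) = 1"
  using rho_sum[OF assms(1), of "\<lambda>_. 1"] fin_digraph.finite_arcs[OF assms(1)] assms(2) by auto

lemma rho_outside_verts:
  assumes "wf_digraph G" "v \<notin> verts G"
  shows "rho_out G v = 0" "rho_in G v = 0"
proof -
  interpret wf_digraph G by fact
  have "out_arcs G v = {}" "in_arcs G v = {}" using assms(2) by (auto simp: out_arcs_def in_arcs_def)
  then show "rho_out G v = 0" "rho_in G v = 0"
    by (simp_all add: rho_out_def rho_in_def out_degree_def in_degree_def)
qed

lemma selection_prob_nonneg: "0 \<le> selection_prob G a b c s"
  by (cases s) (auto intro!: mult_nonneg_nonneg prod_list_nonneg divide_nonneg_nonneg sum_nonneg simp: rho_out_def rho_in_def)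

lemma selection_prob_eq_0:
  assumes "wf_digraph G" "\<not> selection_ok G a b c s"
  shows "selection_prob G a b c s = 0"
proof -
  obtain xs ys ws ws' where s: "s = (xs, ys, ws, ws')" by (metis prod_cases4)
  have "prod_list (map (rho_out G) vs) = 0" "prod_list (map (rho_in G) vs) = 0" if "\<not> set vs \<subseteq> verts G" for vs
    using that rho_outside_verts[OF assms(1)] by (force simp: prod_list_zero_iff)+
  with assms(2) show ?thesis by (auto simp: s)
qed

lemma selection_cost_nonneg: "0 \<le> selection_cost G q s"
  by (cases s) (auto intro!: add_nonneg_nonneg sum_list_nonneg)

text \<open>A sample is the tail or the head of a uniform arc, and neither end is deeper than the
  arc.\<close>

lemma expected_depth_weight_le:
  assumes "fin_digraph G"
  shows "(\<Sum>v\<in>verts G. rho_out G v * exp (real (depth G v))) \<le> potential G / real (card (arcs G))"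
    and "(\<Sum>v\<in>verts G. rho_in G v * exp (real (depth G v))) \<le> potential G / real (card (arcs G))"
  unfolding rho_sum[OF assms] potential_def arc_depth_def
  by (auto intro!: divide_right_mono sum_mono)

text \<open>There are \<open>a + b + c\<close> charged samples and one of them is charged
  \<open>q\<close> further times. By linearity each charge has mean at most the average weight of an
  arc.\<close>

lemma expected_selection_cost_le:
  fixes G :: "('v vtx, 'e) pre_digraph"
  assumes G: "fin_digraph G" "arcs G \<noteq> {}" and ab: "a + b > 0"
  shows "(\<integral>\<^sup>+s. ennreal (selection_prob G a b c s) * ennreal (selection_cost G q s) \<partial>count_space UNIV)
    \<le> ennreal (real (a + b + c + q) * potential G / real (card (arcs G)))"
proof -
  interpret fin_digraph G by fact
  let ?V = "verts G"
  let ?w = "\<lambda>v. exp (real (depth G v))"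
  let ?E = "potential G / real (card (arcs G))"
  let ?po = "\<lambda>xs. prod_list (map (rho_out G) xs)"
  let ?pi = "\<lambda>xs. prod_list (map (rho_in G) xs)"
  \<comment> \<open>The head of \<open>xs @ ys\<close> lies in \<open>xs\<close> if
    \<open>a > 0\<close> and in \<open>ys\<close> otherwise. Giving the loops to \<open>f\<close> or
    to \<open>g\<close> accordingly makes the cost a sum of functions of single lists; the
    coefficient 0 cancels any value of \<open>hd []\<close>.\<close>
  define f where "f xs = (\<Sum>x\<leftarrow>xs. ?w x) + (if a > 0 then real q else 0) * ?w (hd xs)" for xs
  define g where "g ys = (\<Sum>y\<leftarrow>ys. ?w y) + (if a > 0 then 0 else real q) * ?w (hd ys)" for ys
  define h where "h ws = (\<Sum>w\<leftarrow>ws. ?w w)" for ws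
  let ?T = "lists_of_length ?V a \<times> lists_of_length ?V b \<times> lists_of_length ?V c \<times> lists_of_length ?V c"
  have fin: "finite ?T" by (intro finite_cartesian_product finite_lists_length_eq finite_verts)
  \<comment> \<open>All selections outside \<open>?T\<close> have probability 0, so the integral
    over the whole type is a finite sum.\<close>
  have "(\<integral>\<^sup>+s. ennreal (selection_prob G a b c s) * ennreal (selection_cost G q s) \<partial>count_space UNIV)
      = (\<Sum>s\<in>?T. ennreal (selection_prob G a b c s) * ennreal (selection_cost G q s))"
  proof (rule nn_integral_count_space'[OF fin])
    fix s assume "s \<notin> ?T"
    then have "\<not> selection_ok G a b c s" by (cases s) auto
    then show "ennreal (selection_prob G a b c s) * ennreal (selection_cost G q s) = 0"
      by (simp add: selection_prob_eq_0 wf_digraph)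
  qed simp
  also have "\<dots> = ennreal (\<Sum>s\<in>?T. selection_prob G a b c s * selection_cost G q s)"
    by (simp add: ennreal_mult'[symmetric] selection_prob_nonneg selection_cost_nonneg)
  also have "(\<Sum>s\<in>?T. selection_prob G a b c s * selection_cost G q s) =
      (\<Sum>(xs, ys, ws, ws')\<in>?T. ?po xs * ?pi ys * ?po ws * ?pi ws' * (f xs + g ys + h ws))"
  proof (rule sum.cong[OF refl])
    fix s assume s: "s \<in> ?T"
    obtain xs ys ws ws' where s': "s = (xs, ys, ws, ws')" by (metis prod_cases4)
    have "selection_cost G q s = f xs + g ys + h ws"
      using s ab by (cases "a = 0") (auto simp: s' f_def g_def h_def hd_append)
    then show "selection_prob G a b c s * selection_cost G q s =
        (case s of (xs, ys, ws, ws') \<Rightarrow> ?po xs * ?pi ys * ?po ws * ?pi ws' * (f xs + g ys + h ws))"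
      using s by (auto simp: s')
  qed
  also have "\<dots> = (\<Sum>xs\<in>lists_of_length ?V a. ?po xs * f xs) + (\<Sum>ys\<in>lists_of_length ?V b. ?pi ys * g ys)
      + (\<Sum>ws\<in>lists_of_length ?V c. ?po ws * h ws)"
    by (rule sum_product_weights) (simp_all only: sum_prod_list rho_sum_1[OF G] power_one)
  also have "\<dots> \<le> (real a + (if a > 0 then real q else 0)) * ?E + (real b + (if a > 0 then 0 else real q)) * ?E
      + real c * ?E"
  proof (intro add_mono)
    let ?o = "\<Sum>v\<in>?V. rho_out G v * ?w v"
    let ?i = "\<Sum>v\<in>?V. rho_in G v * ?w v"
    have "(\<Sum>xs\<in>lists_of_length ?V a. ?po xs * f xs) = (real a + (if a > 0 then real q else 0)) * ?o"
    proof (cases "a > 0")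
      case True
      have "(\<Sum>xs\<in>lists_of_length ?V a. ?po xs * f xs) =
          (\<Sum>xs\<in>lists_of_length ?V a. ?po xs * (\<Sum>x\<leftarrow>xs. ?w x)) +
          real q * (\<Sum>xs\<in>lists_of_length ?V a. ?po xs * ?w (hd xs))"
        using True by (simp add: f_def sum_distrib_left sum.distrib algebra_simps)
      then show ?thesis
        using True sum_prod_list_hd[OF rho_sum_1(1)[OF G] True, of ?w] sum_prod_list_sum_list[OF rho_sum_1(1)[OF G], of ?w a]
        by (simp add: distrib_right)
    next
      case False
      then show ?thesis using sum_prod_list_sum_list[OF rho_sum_1(1)[OF G], of ?w a] by (simp add: f_def)
    qed
    also have "\<dots> \<le> (real a + (if a > 0 then real q else 0)) * ?E"
      by (intro mult_left_mono expected_depth_weight_le G) auto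
    finally show "(\<Sum>xs\<in>lists_of_length ?V a. ?po xs * f xs) \<le> (real a + (if a > 0 then real q else 0)) * ?E" .
    have "(\<Sum>ys\<in>lists_of_length ?V b. ?pi ys * g ys) = (real b + (if a > 0 then 0 else real q)) * ?i"
    proof (cases "a > 0")
      case False
      with ab have b: "b > 0" by simp
      have "(\<Sum>ys\<in>lists_of_length ?V b. ?pi ys * g ys) =
          (\<Sum>ys\<in>lists_of_length ?V b. ?pi ys * (\<Sum>y\<leftarrow>ys. ?w y)) +
          real q * (\<Sum>ys\<in>lists_of_length ?V b. ?pi ys * ?w (hd ys))"
        using False by (simp add: g_def sum_distrib_left sum.distrib algebra_simps)
      then show ?thesis
        using False sum_prod_list_hd[OF rho_sum_1(2)[OF G] b, of ?w] sum_prod_list_sum_list[OF rho_sum_1(2)[OF G], of ?w b]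
        by (simp add: distrib_right)
    next
      case True
      then show ?thesis using sum_prod_list_sum_list[OF rho_sum_1(2)[OF G], of ?w b] by (simp add: g_def)
    qed
    also have "\<dots> \<le> (real b + (if a > 0 then 0 else real q)) * ?E"
      by (intro mult_left_mono expected_depth_weight_le G) auto
    finally show "(\<Sum>ys\<in>lists_of_length ?V b. ?pi ys * g ys) \<le> (real b + (if a > 0 then 0 else real q)) * ?E" .
    have "(\<Sum>ws\<in>lists_of_length ?V c. ?po ws * h ws) = real c * ?o"
      using sum_prod_list_sum_list[OF rho_sum_1(1)[OF G], of ?w c] by (simp add: h_def)
    also have "\<dots> \<le> real c * ?E"
      by (intro mult_left_mono expected_depth_weight_le G) auto
    finally show "(\<Sum>ws\<in>lists_of_length ?V c. ?po ws * h ws) \<le> real c * ?E" .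
  qed
  also have "\<dots> = real (a + b + c + q) * potential G / real (card (arcs G))"
    by (simp add: algebra_simps add_divide_distrib)
  finally show ?thesis by (simp add: ennreal_leI)
qed

section \<open>The expected potential of the process\<close>

lemma measurable_count_space_combine:
  fixes f :: "'w \<Rightarrow> 'a :: countable" and g :: "'w \<Rightarrow> 'b :: countable"
  assumes "f \<in> M \<rightarrow>\<^sub>M count_space UNIV" "g \<in> M \<rightarrow>\<^sub>M count_space UNIV"
  shows "(\<lambda>\<omega>. h (f \<omega>) (g \<omega>)) \<in> M \<rightarrow>\<^sub>M count_space UNIV"
proof -
  have "(\<lambda>\<omega>. (f \<omega>, g \<omega>)) \<in> M \<rightarrow>\<^sub>M count_space UNIV \<Otimes>\<^sub>M count_space UNIV"
    using assms by (rule measurable_Pair)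
  then have "(\<lambda>\<omega>. (f \<omega>, g \<omega>)) \<in> M \<rightarrow>\<^sub>M count_space UNIV"
    by (simp add: pair_measure_countable)
  from measurable_compose[OF this, of "\<lambda>(x, y). h x y" "count_space UNIV"] show ?thesis by simp
qed

lemma measurable_count_space_map:
  fixes f :: "nat \<Rightarrow> 'w \<Rightarrow> 'a :: countable"
  assumes "\<And>r. r \<in> set rs \<Longrightarrow> f r \<in> M \<rightarrow>\<^sub>M count_space UNIV"
  shows "(\<lambda>\<omega>. map (\<lambda>r. f r \<omega>) rs) \<in> M \<rightarrow>\<^sub>M count_space UNIV"
  using assms
proof (induction rs)
  case (Cons r rs)
  then show ?case using measurable_count_space_combine[of "f r" M "\<lambda>\<omega>. map (\<lambda>r. f r \<omega>) rs" "(#)"] by simp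
qed simp

text \<open>The integrand is constant on each atom of \<open>H\<close>, and countability allows the
  sum over atoms to be exchanged with the integral.\<close>

lemma nn_integral_countable_rv:
  fixes H :: "'w \<Rightarrow> 'h :: countable" and g :: "'h \<Rightarrow> ennreal"
  assumes H: "H \<in> M \<rightarrow>\<^sub>M count_space UNIV"
  shows "(\<integral>\<^sup>+\<omega>. g (H \<omega>) \<partial>M) = (\<integral>\<^sup>+h. g h * emeasure M {\<omega>\<in>space M. H \<omega> = h} \<partial>count_space UNIV)"
proof -
  have sets: "{\<omega>\<in>space M. H \<omega> = h} \<in> sets M" for h
    using measurable_sets[OF H, of "{h}"] by (simp add: vimage_def Int_def conj_commute)
  have "(\<integral>\<^sup>+\<omega>. g (H \<omega>) \<partial>M) =
      (\<integral>\<^sup>+\<omega>. (\<integral>\<^sup>+h. g h * indicator {\<omega>\<in>space M. H \<omega> = h} \<omega> \<partial>count_space UNIV) \<partial>M)"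
  proof (rule nn_integral_cong)
    fix \<omega> assume "\<omega> \<in> space M"
    then show "g (H \<omega>) = (\<integral>\<^sup>+h. g h * indicator {\<omega>\<in>space M. H \<omega> = h} \<omega> \<partial>count_space UNIV)"
      by (subst nn_integral_count_space'[of "{H \<omega>}"]) auto
  qed
  also have "\<dots> = (\<integral>\<^sup>+h. (\<integral>\<^sup>+\<omega>. g h * indicator {\<omega>\<in>space M. H \<omega> = h} \<omega> \<partial>M) \<partial>count_space UNIV)"
    using sets by (intro nn_integral_count_space_nn_integral) auto
  also have "\<dots> = (\<integral>\<^sup>+h. g h * emeasure M {\<omega>\<in>space M. H \<omega> = h} \<partial>count_space UNIV)"
    using sets by (simp add: nn_integral_cmult_indicator)
  finally show ?thesis .
qed

section \<open>The history of the process and conditioning on its atoms\<close>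

context acl_process
begin

definition graph :: "nat \<Rightarrow> 'w \<Rightarrow> ('v vtx, 'e edg) pre_digraph" where
  "graph t \<omega> = acl_graph G0 (\<lambda>r. Q r \<omega>) (\<lambda>r. S r \<omega>) t"

text \<open>These are the data on which \<open>cond_selection\<close> conditions: selections
  strictly before \<open>t\<close>, but counts up to and including \<open>t\<close>.\<close>

definition history :: "nat \<Rightarrow> 'w \<Rightarrow> 'v vtx selection list \<times> (nat \<times> nat \<times> nat \<times> nat) list" where
  "history t \<omega> = (map (\<lambda>r. S r \<omega>) [1..<t], map (\<lambda>r. (X r \<omega>, Y r \<omega>, Z r \<omega>, Q r \<omega>)) [1..<Suc t])"

lemma graph_Suc: "graph (Suc t) \<omega> = grow (Suc t) (Q (Suc t) \<omega>) (S (Suc t) \<omega>) (graph t \<omega>)"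
  by (simp add: graph_def)

lemma history_eq_iff:
  "history t \<omega> = history t \<omega>' \<longleftrightarrow> (\<forall>r\<in>{1..<t}. S r \<omega> = S r \<omega>') \<and>
    (\<forall>r\<in>{1..t}. X r \<omega> = X r \<omega>' \<and> Y r \<omega> = Y r \<omega>' \<and> Z r \<omega> = Z r \<omega>' \<and> Q r \<omega> = Q r \<omega>')"
  unfolding history_def by (auto simp del: upt_Suc simp add: atLeastLessThanSuc_atLeastAtMost)

text \<open>The history at \<open>Suc t\<close> contains the selections and loop counts up to
  \<open>t\<close>, which drive the recursion up to time \<open>t\<close>.\<close>

lemma graph_eqI:
  assumes "history (Suc t) \<omega> = history (Suc t) \<omega>'"
  shows "graph t \<omega> = graph t \<omega>'"
proof -
  have eq: "\<forall>r\<in>{1..t}. S r \<omega> = S r \<omega>' \<and> Q r \<omega> = Q r \<omega>'"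
    using assms by (auto simp: history_eq_iff)
  have "k \<le> t \<Longrightarrow> graph k \<omega> = graph k \<omega>'" for k
  proof (induction k)
    case (Suc k)
    then show ?case using eq by (simp add: graph_Suc)
  qed (simp add: graph_def)
  then show ?thesis by simp
qed

lemma measurable_history: "history t \<in> M \<rightarrow>\<^sub>M count_space UNIV"
proof -
  have "(\<lambda>\<omega>. map (\<lambda>r. S r \<omega>) [1..<t]) \<in> M \<rightarrow>\<^sub>M count_space UNIV"
    by (rule measurable_count_space_map) (auto intro: rv_S)
  moreover have "(\<lambda>\<omega>. (X r \<omega>, Y r \<omega>, Z r \<omega>, Q r \<omega>)) \<in> M \<rightarrow>\<^sub>M count_space UNIV" if "r \<ge> 1" for r
    using that by (intro measurable_count_space_combine[where h = Pair] rv_X rv_Y rv_Z rv_Q)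
  then have "(\<lambda>\<omega>. map (\<lambda>r. (X r \<omega>, Y r \<omega>, Z r \<omega>, Q r \<omega>)) [1..<Suc t]) \<in> M \<rightarrow>\<^sub>M count_space UNIV"
    by (intro measurable_count_space_map) auto
  ultimately show ?thesis unfolding history_def by (rule measurable_count_space_combine)
qed

text \<open>A canonical point of each atom, since \<open>cond_selection\<close> names an atom by one
  of its points; arbitrary if \<open>space M\<close> contains no point of the atom.\<close>

definition history_point :: "nat \<Rightarrow> 'v vtx selection list \<times> (nat \<times> nat \<times> nat \<times> nat) list \<Rightarrow> 'w" where
  "history_point t h = (SOME \<omega>. \<omega> \<in> space M \<and> history t \<omega> = h)"

lemma history_point: "\<omega> \<in> space M \<Longrightarrow>
    history_point t (history t \<omega>) \<in> space M \<and> history t (history_point t (history t \<omega>)) = history t \<omega>"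
  unfolding history_point_def by (rule someI[of _ \<omega>]) simp

text \<open>Such a \<open>g\<close> agrees on \<open>space M\<close> with a function of the discrete
  variable \<open>history t\<close>. This replaces a sigma-algebra on graphs.\<close>

lemma measurable_of_history:
  assumes "\<And>\<omega> \<omega>'. history t \<omega> = history t \<omega>' \<Longrightarrow> g \<omega> = g \<omega>'" and N: "space N = UNIV"
  shows "g \<in> M \<rightarrow>\<^sub>M N"
proof -
  have "(\<lambda>\<omega>. g (history_point t (history t \<omega>))) \<in> M \<rightarrow>\<^sub>M N"
    by (rule measurable_compose[OF measurable_history]) (simp add: N)
  moreover have "g (history_point t (history t \<omega>)) = g \<omega>" if "\<omega> \<in> space M" for \<omega>
    using history_point[OF that] assms(1) by blast
  ultimately show ?thesis by (simp cong: measurable_cong)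
qed

text \<open>The tower property: average over the selection at time \<open>Suc t\<close> first, given
  the history. Both sides are expanded over the atoms of the history and, on the left, of the
  selection as well.\<close>

lemma nn_integral_selection:
  fixes f :: "'w \<Rightarrow> 'v vtx selection \<Rightarrow> ennreal"
  assumes f: "\<forall>\<omega> \<omega>'. history (Suc t) \<omega> = history (Suc t) \<omega>' \<longrightarrow> f \<omega> = f \<omega>'"
  shows "(\<integral>\<^sup>+\<omega>. f \<omega> (S (Suc t) \<omega>) \<partial>M) =
    (\<integral>\<^sup>+\<omega>. (\<integral>\<^sup>+s. ennreal (selection_prob (graph t \<omega>) (X (Suc t) \<omega>) (Y (Suc t) \<omega>) (Z (Suc t) \<omega>) s) *
      f \<omega> s \<partial>count_space UNIV) \<partial>M)"
proof -
  let ?H = "history (Suc t)" and ?p = "history_point (Suc t)"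
  define P where "P \<omega> s = ennreal (selection_prob (graph t \<omega>) (X (Suc t) \<omega>) (Y (Suc t) \<omega>) (Z (Suc t) \<omega>) s)"
    for \<omega> s
  have P: "P \<omega> s = P \<omega>' s" if "?H \<omega> = ?H \<omega>'" for \<omega> \<omega>' s
    using graph_eqI[OF that] that by (auto simp: P_def history_eq_iff)
  have rep: "f (?p (?H \<omega>)) s = f \<omega> s" "P (?p (?H \<omega>)) s = P \<omega> s" if "\<omega> \<in> space M" for \<omega> s
    using history_point[OF that] f P by metis+
  have sets: "{\<omega>\<in>space M. ?H \<omega> = h} \<in> sets M" for h
    using measurable_sets[OF measurable_history, of "{h}"] by (simp add: vimage_def Int_def conj_commute)
  \<comment> \<open>Null atoms are treated apart because \<open>cond_selection\<close> covers only
    atoms of positive probability; on null atoms both sides are 0.\<close>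
  have atom: "emeasure M {\<omega>\<in>space M. (?H \<omega>, S (Suc t) \<omega>) = (h, s)} = P (?p h) s * emeasure M {\<omega>\<in>space M. ?H \<omega> = h}"
    for h s
  proof (cases "measure M {\<omega>\<in>space M. ?H \<omega> = h} = 0")
    case True
    then have "emeasure M {\<omega>\<in>space M. ?H \<omega> = h} = 0" by (simp add: emeasure_eq_measure)
    moreover have "emeasure M {\<omega>\<in>space M. (?H \<omega>, S (Suc t) \<omega>) = (h, s)} \<le> emeasure M {\<omega>\<in>space M. ?H \<omega> = h}"
      using sets by (intro emeasure_mono) auto
    ultimately show ?thesis by simp
  next
    case False
    then obtain \<omega>\<^sub>1 where "\<omega>\<^sub>1 \<in> space M" "?H \<omega>\<^sub>1 = h" by (metis (mono_tags, lifting) empty_Collect_eq measure_empty)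
    then have p: "?p h \<in> space M" "?H (?p h) = h" using history_point by blast+
    have H: "?H \<omega> = h \<longleftrightarrow> (\<forall>r\<in>{1..<Suc t}. S r \<omega> = S r (?p h)) \<and>
        (\<forall>r\<in>{1..Suc t}. X r \<omega> = X r (?p h) \<and> Y r \<omega> = Y r (?p h) \<and> Z r \<omega> = Z r (?p h) \<and> Q r \<omega> = Q r (?p h))" for \<omega>
      using history_eq_iff[of "Suc t" \<omega> "?p h"] p(2) by metis
    have pos: "measure M {\<omega>\<in>space M. ?H \<omega> = h} > 0" using False by (simp add: zero_less_measure_iff)
    have "\<P>(\<omega> in M. S (Suc t) \<omega> = s \<bar> ?H \<omega> = h) =
        selection_prob (graph t (?p h)) (X (Suc t) (?p h)) (Y (Suc t) (?p h)) (Z (Suc t) (?p h)) s"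
      using cond_selection[of "Suc t" "?p h" s] p(1) pos unfolding H graph_def by simp
    then have "measure M {\<omega>\<in>space M. S (Suc t) \<omega> = s \<and> ?H \<omega> = h} =
        selection_prob (graph t (?p h)) (X (Suc t) (?p h)) (Y (Suc t) (?p h)) (Z (Suc t) (?p h)) s *
        measure M {\<omega>\<in>space M. ?H \<omega> = h}"
      using pos by (simp add: cond_prob_def field_simps)
    then show ?thesis
      by (simp add: emeasure_eq_measure P_def ennreal_mult'[symmetric] selection_prob_nonneg conj_commute)
  qed
  have "(\<lambda>\<omega>. (?H \<omega>, S (Suc t) \<omega>)) \<in> M \<rightarrow>\<^sub>M count_space UNIV"
    by (intro measurable_count_space_combine[where h = Pair] measurable_history rv_S) simp
  note int_pair = nn_integral_countable_rv[OF this, of "\<lambda>(h, s). f (?p h) s"]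
  have "(\<integral>\<^sup>+\<omega>. f \<omega> (S (Suc t) \<omega>) \<partial>M) = (\<integral>\<^sup>+\<omega>. (case (?H \<omega>, S (Suc t) \<omega>) of (h, s) \<Rightarrow> f (?p h) s) \<partial>M)"
    by (intro nn_integral_cong) (simp add: rep)
  also have "\<dots> = (\<integral>\<^sup>+x. (case x of (h, s) \<Rightarrow> f (?p h) s) *
      emeasure M {\<omega>\<in>space M. (?H \<omega>, S (Suc t) \<omega>) = x} \<partial>count_space UNIV)"
    by (rule int_pair)
  also have "\<dots> = (\<integral>\<^sup>+x. (case x of (h, s) \<Rightarrow> P (?p h) s * f (?p h) s * emeasure M {\<omega>\<in>space M. ?H \<omega> = h}) \<partial>count_space UNIV)"
    by (intro nn_integral_cong) (auto simp only: atom prod.case ac_simps split: prod.split)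
  also have "\<dots> = (\<integral>\<^sup>+h. (\<integral>\<^sup>+s. P (?p h) s * f (?p h) s * emeasure M {\<omega>\<in>space M. ?H \<omega> = h} \<partial>count_space UNIV) \<partial>count_space UNIV)"
    by (subst nn_integral_fst_count_space[symmetric]) simp
  also have "\<dots> = (\<integral>\<^sup>+h. (\<integral>\<^sup>+s. P (?p h) s * f (?p h) s \<partial>count_space UNIV) * emeasure M {\<omega>\<in>space M. ?H \<omega> = h} \<partial>count_space UNIV)"
    by (intro nn_integral_cong nn_integral_multc) simp
  also have "\<dots> = (\<integral>\<^sup>+\<omega>. (\<integral>\<^sup>+s. P (?p (?H \<omega>)) s * f (?p (?H \<omega>)) s \<partial>count_space UNIV) \<partial>M)"
    by (rule nn_integral_countable_rv[OF measurable_history, symmetric])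
  also have "\<dots> = (\<integral>\<^sup>+\<omega>. (\<integral>\<^sup>+s. P \<omega> s * f \<omega> s \<partial>count_space UNIV) \<partial>M)"
    by (intro nn_integral_cong) (simp add: rep)
  finally show ?thesis unfolding P_def .
qed

text \<open>Integrate the indicator of an invalid selection: given the history it lives where
  \<open>selection_prob\<close> vanishes, so the integral is 0.\<close>

lemma AE_selection_ok:
  assumes "AE \<omega> in M. wf_digraph (graph t \<omega>)"
  shows "AE \<omega> in M. selection_ok (graph t \<omega>) (X (Suc t) \<omega>) (Y (Suc t) \<omega>) (Z (Suc t) \<omega>) (S (Suc t) \<omega>)"
proof -
  \<comment> \<open>Well-formedness is part of the indicator, so that \<open>null\<close> below
    holds at every point and not just almost everywhere.\<close>
  define f :: "'w \<Rightarrow> 'v vtx selection \<Rightarrow> ennreal" where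
    "f \<omega> s = (if wf_digraph (graph t \<omega>) \<and> \<not> selection_ok (graph t \<omega>) (X (Suc t) \<omega>) (Y (Suc t) \<omega>) (Z (Suc t) \<omega>) s
      then 1 else 0)" for \<omega> s
  have f: "\<forall>\<omega> \<omega>'. history (Suc t) \<omega> = history (Suc t) \<omega>' \<longrightarrow> f \<omega> = f \<omega>'"
  proof (intro allI impI)
    fix \<omega> \<omega>' assume eq: "history (Suc t) \<omega> = history (Suc t) \<omega>'"
    show "f \<omega> = f \<omega>'" using graph_eqI[OF eq] eq by (auto simp: f_def history_eq_iff fun_eq_iff)
  qed
  have null: "ennreal (selection_prob (graph t \<omega>) (X (Suc t) \<omega>) (Y (Suc t) \<omega>) (Z (Suc t) \<omega>) s) * f \<omega> s = 0" for \<omega> s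
    by (simp add: f_def selection_prob_eq_0)
  have "(\<integral>\<^sup>+\<omega>. f \<omega> (S (Suc t) \<omega>) \<partial>M) = 0"
    unfolding nn_integral_selection[of t f, OF f] null by simp
  moreover have "(\<lambda>\<omega>. f \<omega> (S (Suc t) \<omega>)) \<in> borel_measurable M"
  \<comment> \<open>The selection at time \<open>Suc t\<close> enters the history only at the next
    index.\<close>
  proof (rule measurable_of_history[of "Suc (Suc t)"])
    fix \<omega> \<omega>' assume "history (Suc (Suc t)) \<omega> = history (Suc (Suc t)) \<omega>'"
    then have "history (Suc t) \<omega> = history (Suc t) \<omega>'" "S (Suc t) \<omega> = S (Suc t) \<omega>'"
      by (auto simp: history_eq_iff)
    with f show "f \<omega> (S (Suc t) \<omega>) = f \<omega>' (S (Suc t) \<omega>')" by metis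
  qed simp
  ultimately have "AE \<omega> in M. f \<omega> (S (Suc t) \<omega>) = 0"
    by (simp add: nn_integral_0_iff_AE)
  with assms show ?thesis by eventually_elim (auto simp: f_def split: if_splits)
qed

text \<open>The initial graph has an arc and each step adds at least \<open>l\<close> more. The
  claim is almost sure because invalid selections and violated bounds are excluded only up to null
  sets.\<close>

lemma AE_process_graph:
  assumes "\<And>t. t \<ge> 1 \<Longrightarrow> AE \<omega> in M. l \<le> X t \<omega> + Y t \<omega> + Z t \<omega> + Q t \<omega>"
  shows "AE \<omega> in M. process_graph G0 t (graph t \<omega>) \<and> 1 + l * t \<le> card (arcs (graph t \<omega>))"
proof (induction t)
  case 0
  have "card (arcs G0) \<ge> 1"
    using arcs_G0 fin_digraph.finite_arcs[OF fin_digraph_G0] by (simp add: Suc_le_eq card_gt_0_iff)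
  then show ?case
    using process_graph_initial[OF fin_digraph_G0] by (simp add: graph_def card_image)
next
  case (Suc t)
  have "AE \<omega> in M. wf_digraph (graph t \<omega>)"
    using Suc by eventually_elim (auto simp: process_graph_def fin_digraph_def)
  from AE_selection_ok[OF this] Suc assms[of "Suc t", simplified] XY_pos[of "Suc t", simplified]
  show ?case
  proof eventually_elim
    case (elim \<omega>)
    then show ?case using grow_step(1,2)[of G0 t "graph t \<omega>", OF _ elim(1)] by (simp add: graph_Suc)
  qed
qed

section \<open>Growth of the expected potential and Markov's inequality\<close>

lemma measurable_potential: "(\<lambda>\<omega>. ennreal (potential (graph t \<omega>))) \<in> borel_measurable M"
  by (rule measurable_of_history[of "Suc t"]) (auto dest: graph_eqI)

text \<open>The increment is at most \<open>exp 1\<close> times the selection cost. Its conditional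
  mean is bounded by replacing the random number of new arcs by \<open>u\<close> and the random
  number of old arcs by \<open>1 + l * t\<close>.\<close>

lemma expected_potential_Suc:
  assumes l: "\<And>t. t \<ge> 1 \<Longrightarrow> AE \<omega> in M. l \<le> X t \<omega> + Y t \<omega> + Z t \<omega> + Q t \<omega>"
    and u: "\<And>t. t \<ge> 1 \<Longrightarrow> AE \<omega> in M. X t \<omega> + Y t \<omega> + Z t \<omega> + Q t \<omega> \<le> u"
  shows "(\<integral>\<^sup>+\<omega>. ennreal (potential (graph (Suc t) \<omega>)) \<partial>M) \<le>
    ennreal (1 + exp 1 * real u / real (1 + l * t)) * (\<integral>\<^sup>+\<omega>. ennreal (potential (graph t \<omega>)) \<partial>M)"
proof -
  let ?c = "\<lambda>\<omega> s. ennreal (selection_cost (graph t \<omega>) (Q (Suc t) \<omega>) s)"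
  have c: "\<forall>\<omega> \<omega>'. history (Suc t) \<omega> = history (Suc t) \<omega>' \<longrightarrow> ?c \<omega> = ?c \<omega>'"
  proof (intro allI impI)
    fix \<omega> \<omega>' assume eq: "history (Suc t) \<omega> = history (Suc t) \<omega>'"
    show "?c \<omega> = ?c \<omega>'" using graph_eqI[OF eq] eq by (auto simp: history_eq_iff)
  qed
  have c_meas: "(\<lambda>\<omega>. ?c \<omega> (S (Suc t) \<omega>)) \<in> borel_measurable M"
  proof (rule measurable_of_history[of "Suc (Suc t)"])
    fix \<omega> \<omega>' assume "history (Suc (Suc t)) \<omega> = history (Suc (Suc t)) \<omega>'"
    then have "history (Suc t) \<omega> = history (Suc t) \<omega>'" "S (Suc t) \<omega> = S (Suc t) \<omega>'"
      by (auto simp: history_eq_iff)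
    with c show "?c \<omega> (S (Suc t) \<omega>) = ?c \<omega>' (S (Suc t) \<omega>')" by metis
  qed simp
  have pot: "0 \<le> potential G" for G :: "('v vtx, 'e edg) pre_digraph"
    unfolding potential_def by (intro sum_nonneg) simp
  have pg: "AE \<omega> in M. process_graph G0 t (graph t \<omega>) \<and> 1 + l * t \<le> card (arcs (graph t \<omega>))"
    by (rule AE_process_graph[OF l])
  then have "AE \<omega> in M. wf_digraph (graph t \<omega>)"
    by eventually_elim (auto simp: process_graph_def fin_digraph_def)
  note ok = AE_selection_ok[OF this]
  have "(\<integral>\<^sup>+\<omega>. ennreal (potential (graph (Suc t) \<omega>)) \<partial>M) \<le>
      (\<integral>\<^sup>+\<omega>. ennreal (potential (graph t \<omega>)) + ennreal (exp 1) * ?c \<omega> (S (Suc t) \<omega>) \<partial>M)"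
  proof (rule nn_integral_mono_AE)
    show "AE \<omega> in M. ennreal (potential (graph (Suc t) \<omega>)) \<le>
        ennreal (potential (graph t \<omega>)) + ennreal (exp 1) * ?c \<omega> (S (Suc t) \<omega>)"
      using ok pg XY_pos[of "Suc t", simplified]
    proof eventually_elim
      case (elim \<omega>)
      then have "potential (graph (Suc t) \<omega>) \<le> potential (graph t \<omega>) +
          exp 1 * selection_cost (graph t \<omega>) (Q (Suc t) \<omega>) (S (Suc t) \<omega>)"
        unfolding graph_Suc by (intro grow_step(3)[OF _ elim(1)]) auto
      then show ?case
        by (simp add: ennreal_mult'[symmetric] ennreal_plus[symmetric] pot selection_cost_nonneg del: ennreal_plus)
    qed
  qed
  also have "\<dots> = (\<integral>\<^sup>+\<omega>. ennreal (potential (graph t \<omega>)) \<partial>M) + ennreal (exp 1) * (\<integral>\<^sup>+\<omega>. ?c \<omega> (S (Suc t) \<omega>) \<partial>M)"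
    using c_meas measurable_potential by (simp add: nn_integral_add nn_integral_cmult)
  also have "(\<integral>\<^sup>+\<omega>. ?c \<omega> (S (Suc t) \<omega>) \<partial>M) \<le>
      (\<integral>\<^sup>+\<omega>. ennreal (real u / real (1 + l * t)) * ennreal (potential (graph t \<omega>)) \<partial>M)"
    unfolding nn_integral_selection[of t ?c, OF c]
  proof (rule nn_integral_mono_AE)
    show "AE \<omega> in M. (\<integral>\<^sup>+s. ennreal (selection_prob (graph t \<omega>) (X (Suc t) \<omega>) (Y (Suc t) \<omega>) (Z (Suc t) \<omega>) s) *
        ?c \<omega> s \<partial>count_space UNIV) \<le> ennreal (real u / real (1 + l * t)) * ennreal (potential (graph t \<omega>))"
      using pg XY_pos[of "Suc t", simplified] u[of "Suc t", simplified]
    proof eventually_elim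
      case (elim \<omega>)
      let ?m = "X (Suc t) \<omega> + Y (Suc t) \<omega> + Z (Suc t) \<omega> + Q (Suc t) \<omega>"
      have "arcs (graph t \<omega>) \<noteq> {}" using elim(1) by force
      then have "(\<integral>\<^sup>+s. ennreal (selection_prob (graph t \<omega>) (X (Suc t) \<omega>) (Y (Suc t) \<omega>) (Z (Suc t) \<omega>) s) *
          ?c \<omega> s \<partial>count_space UNIV) \<le> ennreal (real ?m * potential (graph t \<omega>) / real (card (arcs (graph t \<omega>))))"
        using elim by (intro expected_selection_cost_le) (auto simp: process_graph_def)
      also have "real ?m * potential (graph t \<omega>) / real (card (arcs (graph t \<omega>))) \<le>
          real u * potential (graph t \<omega>) / real (1 + l * t)"
      proof (rule frac_le)
        show "real ?m * potential (graph t \<omega>) \<le> real u * potential (graph t \<omega>)"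
          using elim(3) by (intro mult_right_mono pot) (simp only: of_nat_le_iff)
        show "real (1 + l * t) \<le> real (card (arcs (graph t \<omega>)))"
          using elim(1) by (simp only: of_nat_le_iff)
      qed (auto simp: pot add_pos_nonneg)
      finally show ?case by (simp add: ennreal_mult'[symmetric] ennreal_leI pot)
    qed
  qed
  also have "\<dots> = ennreal (real u / real (1 + l * t)) * (\<integral>\<^sup>+\<omega>. ennreal (potential (graph t \<omega>)) \<partial>M)"
    using measurable_potential by (rule nn_integral_cmult)
  finally show ?thesis
    by (simp add: distrib_right ennreal_mult' ennreal_plus mult.assoc mult_left_mono add_left_mono flip: times_divide_eq_right)
qed

text \<open>The one-step factors are multiplied up and \<open>1 + x \<le> exp x\<close> turns the
  product into the exponential of a sum. The initial value counts arcs, as all initial depths are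
  0.\<close>

lemma expected_potential:
  assumes l: "\<And>t. t \<ge> 1 \<Longrightarrow> AE \<omega> in M. l \<le> X t \<omega> + Y t \<omega> + Z t \<omega> + Q t \<omega>"
    and u: "\<And>t. t \<ge> 1 \<Longrightarrow> AE \<omega> in M. X t \<omega> + Y t \<omega> + Z t \<omega> + Q t \<omega> \<le> u"
  shows "(\<integral>\<^sup>+\<omega>. ennreal (potential (graph n \<omega>)) \<partial>M) \<le>
    ennreal (real (card (arcs G0)) * exp (exp 1 * real u * (\<Sum>t<n. 1 / real (1 + l * t))))"
proof (induction n)
  case 0
  then show ?case by (simp add: graph_def potential_initial emeasure_space_1)
next
  case (Suc n)
  let ?E = "\<lambda>n. real (card (arcs G0)) * exp (exp 1 * real u * (\<Sum>t<n. 1 / real (1 + l * t)))"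
  have "(\<integral>\<^sup>+\<omega>. ennreal (potential (graph (Suc n) \<omega>)) \<partial>M) \<le>
      ennreal (1 + exp 1 * real u / real (1 + l * n)) * ennreal (?E n)"
    by (rule order_trans[OF expected_potential_Suc[OF l u] mult_left_mono[OF Suc zero_le]])
  also have "\<dots> = ennreal ((1 + exp 1 * real u / real (1 + l * n)) * ?E n)"
    by (rule ennreal_mult[symmetric]) auto
  also have "\<dots> \<le> ennreal (exp (exp 1 * real u / real (1 + l * n)) * ?E n)"
    by (intro ennreal_leI mult_right_mono exp_ge_add_one_self) auto
  also have "exp (exp 1 * real u / real (1 + l * n)) * ?E n = ?E (Suc n)"
    by (simp add: exp_add distrib_left)
  finally show ?case .
qed

text \<open>A diameter above the bound forces a vertex deeper than \<open>D\<close>, hence a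
  potential of at least \<open>exp D\<close>, which Markov's inequality makes unlikely. The level
  \<open>D\<close> stays free until the theorem.\<close>

lemma prob_diameter_ge:
  assumes l: "\<And>t. t \<ge> 1 \<Longrightarrow> AE \<omega> in M. l \<le> X t \<omega> + Y t \<omega> + Z t \<omega> + Q t \<omega>"
    and u: "\<And>t. t \<ge> 1 \<Longrightarrow> AE \<omega> in M. X t \<omega> + Y t \<omega> + Z t \<omega> + Q t \<omega> \<le> u"
    and K: "real (card (arcs G0)) \<le> K"
  shows "1 - K * exp (exp 1 * real u * (\<Sum>t<n. 1 / real (1 + l * t)) - D) \<le>
    \<P>(\<omega> in M. digraph_diameter (graph n \<omega>) \<le> ereal (2 * D + 2 * K))"
proof -
  let ?good = "{\<omega>\<in>space M. digraph_diameter (graph n \<omega>) \<le> ereal (2 * D + 2 * K)}"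
  \<comment> \<open>The event that the potential is at least \<open>exp D\<close>, in the normalised
    form of Markov's inequality.\<close>
  let ?B = "{\<omega>\<in>space M. 1 \<le> ennreal (exp (- D)) * ennreal (potential (graph n \<omega>))}"
  let ?R = "exp 1 * real u * (\<Sum>t<n. 1 / real (1 + l * t))"
  have good: "?good \<in> events"
  proof -
    have "(\<lambda>\<omega>. digraph_diameter (graph n \<omega>)) \<in> borel_measurable M"
      by (rule measurable_of_history[of "Suc n"]) (auto dest: graph_eqI)
    then show ?thesis by measurable
  qed
  have B: "?B \<in> events" using measurable_potential[of n] by measurable
  have pg: "AE \<omega> in M. process_graph G0 n (graph n \<omega>) \<and> 1 + l * n \<le> card (arcs (graph n \<omega>))"
    by (rule AE_process_graph[OF l])
  have "AE \<omega> in M. \<omega> \<in> space M - ?good \<longrightarrow> \<omega> \<in> ?B"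
    using pg
  proof eventually_elim
    case (elim \<omega>)
    show ?case
    proof
      assume bad: "\<omega> \<in> space M - ?good"
      have "\<exists>v\<in>verts (graph n \<omega>). D < real (depth (graph n \<omega>) v)"
      proof (rule ccontr)
        assume "\<not> ?thesis"
        then have "digraph_diameter (graph n \<omega>) \<le> ereal (2 * D + 2 * real (card (arcs G0)))"
          using elim fin_digraph_G0 weakly_connected_G0 by (intro digraph_diameter_le) (auto simp: not_less)
        also have "\<dots> \<le> ereal (2 * D + 2 * K)" using K by simp
        finally show False using bad by simp
      qed
      then obtain v where v: "v \<in> verts (graph n \<omega>)" "D < real (depth (graph n \<omega>) v)" by blast
      have "arcs (graph n \<omega>) \<noteq> {}" using elim by force
      with elim v(1) have "exp (real (depth (graph n \<omega>) v)) \<le> potential (graph n \<omega>)"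
        by (intro exp_depth_le_potential) auto
      with v(2) have "exp D \<le> potential (graph n \<omega>)" by (meson exp_le_cancel_iff less_imp_le order_trans)
      then have "exp (- D) * exp D \<le> exp (- D) * potential (graph n \<omega>)" by (intro mult_left_mono) auto
      then have "1 \<le> exp (- D) * potential (graph n \<omega>)" by (simp add: exp_minus)
      then have "1 \<le> ennreal (exp (- D)) * ennreal (potential (graph n \<omega>))"
        using ennreal_leI by (fastforce simp: ennreal_mult'[symmetric])
      then show "\<omega> \<in> ?B" using bad by simp
    qed
  qed
  then have "emeasure M (space M - ?good) \<le> emeasure M ?B"
    using B by (intro emeasure_mono_AE) auto
  also have "\<dots> \<le> ennreal (exp (- D)) * (\<integral>\<^sup>+\<omega>. ennreal (potential (graph n \<omega>)) * indicator (space M) \<omega> \<partial>M)"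
    using nn_integral_Markov_inequality[of "\<lambda>\<omega>. ennreal (potential (graph n \<omega>))" "space M" M "ennreal (exp (- D))"]
      measurable_potential[of n] by simp
  also have "(\<integral>\<^sup>+\<omega>. ennreal (potential (graph n \<omega>)) * indicator (space M) \<omega> \<partial>M) =
      (\<integral>\<^sup>+\<omega>. ennreal (potential (graph n \<omega>)) \<partial>M)"
    by (rule nn_integral_cong) simp
  also have "ennreal (exp (- D)) * (\<integral>\<^sup>+\<omega>. ennreal (potential (graph n \<omega>)) \<partial>M) \<le>
      ennreal (exp (- D)) * ennreal (K * exp ?R)"
    by (rule mult_left_mono, rule order_trans[OF expected_potential[OF l u]])
       (auto intro!: ennreal_leI mult_right_mono K)
  also have "\<dots> = ennreal (K * exp (?R - D))"
    by (simp add: ennreal_mult'[symmetric] exp_diff exp_minus field_simps)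
  finally have "measure M (space M - ?good) \<le> K * exp (?R - D)"
    using K by (simp add: emeasure_eq_measure)
  then show ?thesis using prob_compl[OF good] by simp
qed

end

section \<open>The harmonic sum in the exponent and the choice of the depth level\<close>

lemma sum_inverse_linear_le:
  assumes "l > 0" "n > 0"
  shows "(\<Sum>t<n. 1 / real (1 + l * t)) \<le> 2 + ln (real n) / real l"
proof -
  \<comment> \<open>Index 0 contributes 1 and index 1 at most \<open>1 / l\<close>. A later index
    \<open>Suc m\<close> contributes at most \<open>1 / (l * Suc m)\<close>, which is bounded by an
    increment of \<open>ln\<close> divided by \<open>l\<close>, and these telescope.\<close>
  have main: "(\<Sum>t<Suc m. 1 / real (1 + l * t)) \<le> 1 + (1 + ln (real m)) / real l" if "m \<ge> 1" for m
    using that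
  proof (induction m rule: dec_induct)
    case base
    then show ?case using assms(1) by (simp add: field_simps)
  next
    case (step m)
    have "real l * real (Suc m) \<le> real (1 + l * Suc m)"
      unfolding of_nat_mult[symmetric] of_nat_le_iff by simp
    then have "1 / real (1 + l * Suc m) \<le> 1 / (real l * real (Suc m))"
      using assms(1) by (intro frac_le) simp_all
    also have "\<dots> = (1 / real (Suc m)) / real l" by simp
    also have "1 / real (Suc m) \<le> ln (real (Suc m)) - ln (real m)"
      using step(1) ln_diff_le[of "real m" "real (Suc m)"] by (simp add: field_simps)
    finally have "1 / real (1 + l * Suc m) \<le> (ln (real (Suc m)) - ln (real m)) / real l"
      using assms(1) by (simp add: divide_right_mono)
    then show ?case using step.IH by (simp add: distrib_left add_divide_distrib diff_divide_distrib)
  qed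
  \<comment> \<open>Absorbs the contribution of index 1 into the constant 2, the source of the
    summand \<open>8 * exp 1 * u\<close> in the theorem.\<close>
  have l: "1 / real l \<le> 1" using assms(1) by simp
  show ?thesis
  proof (cases "n = 1")
    case True
    then show ?thesis by simp
  next
    case False
    with assms(2) obtain m where m: "n = Suc m" "m \<ge> 1" by (cases n) auto
    have "(\<Sum>t<n. 1 / real (1 + l * t)) \<le> 1 + (1 + ln (real m)) / real l" using main m by simp
    also have "\<dots> \<le> 1 + (1 + ln (real n)) / real l"
      using m assms(1) by (intro add_left_mono divide_right_mono) auto
    finally show ?thesis using l by (simp add: add_divide_distrib)
  qed
qed

theorem theorem3p5:
  fixes M :: "nat \<Rightarrow> 'w measure"
    and G0 :: "nat \<Rightarrow> ('v :: countable, 'e) pre_digraph"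
    and X Y Z Q :: "nat \<Rightarrow> nat \<Rightarrow> 'w \<Rightarrow> nat"
    and S :: "nat \<Rightarrow> nat \<Rightarrow> 'w \<Rightarrow> 'v vtx selection"
    and l u :: "nat \<Rightarrow> nat"
    and K :: nat
  assumes "\<And>n. n \<ge> 1 \<Longrightarrow> acl_process (M n) (G0 n) (X n) (Y n) (Z n) (Q n) (S n)"
    and "\<And>n. n \<ge> 1 \<Longrightarrow> card (verts (G0 n)) + card (arcs (G0 n)) \<le> K"
    and "\<And>n. n \<ge> 1 \<Longrightarrow> l n > 0 \<and> u n > 0"
    and "\<And>n t. n \<ge> 1 \<Longrightarrow> t \<ge> 1 \<Longrightarrow>
      AE \<omega> in M n. l n \<le> X n t \<omega> + Y n t \<omega> + Z n t \<omega> + Q n t \<omega> \<and>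
                   X n t \<omega> + Y n t \<omega> + Z n t \<omega> + Q n t \<omega> \<le> u n"
  shows "\<exists>C :: real.
    (\<lambda>n. \<P>(\<omega> in M n. digraph_diameter (acl_graph (G0 n) (\<lambda>t. Q n t \<omega>) (\<lambda>t. S n t \<omega>) n)
        \<le> ereal (4 * exp 1 * (real (u n) / real (l n)) * ln (real n) + 8 * exp 1 * real (u n) + C)))
      \<longlonglongrightarrow> 1"
proof
  \<comment> \<open>The witness for \<open>C\<close> is \<open>2 * real K\<close>, the share of
    walks inside the initial graph.\<close>
  let ?P = "\<lambda>n. \<P>(\<omega> in M n. digraph_diameter (acl_graph (G0 n) (\<lambda>t. Q n t \<omega>) (\<lambda>t. S n t \<omega>) n)
        \<le> ereal (4 * exp 1 * (real (u n) / real (l n)) * ln (real n) + 8 * exp 1 * real (u n) + 2 * real K))"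
  have lower: "1 - real K / real n \<le> ?P n \<and> ?P n \<le> 1" if n: "n \<ge> 1" for n
  proof
    interpret acl_process "M n" "G0 n" "X n" "Y n" "Z n" "Q n" "S n" by (rule assms(1)[OF n])
    show "?P n \<le> 1" by simp
    have l: "AE \<omega> in M n. l n \<le> X n t \<omega> + Y n t \<omega> + Z n t \<omega> + Q n t \<omega>" if "t \<ge> 1" for t
      using assms(4)[OF n that] by eventually_elim simp
    have u: "AE \<omega> in M n. X n t \<omega> + Y n t \<omega> + Z n t \<omega> + Q n t \<omega> \<le> u n" if "t \<ge> 1" for t
      using assms(4)[OF n that] by eventually_elim simp
    \<comment> \<open>The bounds are compared through the random total at time 1; an almost sure
      statement about constants holds outright in a probability space.\<close>
    have "AE \<omega> in M n. l n \<le> u n" using assms(4)[OF n order_refl] by eventually_elim linarith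
    then have lu: "l n \<le> u n" by simp
    \<comment> \<open>The exponent of the expected potential is \<open>exp 1 * R\<close>, at most
      \<open>exp 1 * A\<close>. The level \<open>D = 2 * exp 1 * A\<close> leaves a failure
      probability of at most \<open>K * exp (- (exp 1 * A))\<close>, hence at most
      \<open>K / n\<close> since \<open>A\<close> is at least \<open>ln n\<close>, and
      \<open>2 * D\<close> gives the two main terms of the bound.\<close>
    define A where "A = 2 * real (u n) + real (u n) / real (l n) * ln (real n)"
    define R where "R = real (u n) * (\<Sum>t<n. 1 / real (1 + l n * t))"
    have "R \<le> real (u n) * (2 + ln (real n) / real (l n))"
      unfolding R_def using assms(3)[OF n] n by (intro mult_left_mono sum_inverse_linear_le) auto
    also have "\<dots> = A" by (simp add: A_def distrib_left)
    finally have RA: "R \<le> A" .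
    have "1 * ln (real n) \<le> real (u n) / real (l n) * ln (real n)"
      using lu assms(3)[OF n] n by (intro mult_right_mono) auto
    then have An: "ln (real n) \<le> A" by (simp add: A_def)
    have "0 \<le> ln (real n)" using n by simp
    with An have A0: "0 \<le> A" by linarith
    have "exp 1 * R - 2 * exp 1 * A \<le> - (exp 1 * A)" using RA by simp
    also have "\<dots> \<le> - (1 * A)" using A0 by (intro le_imp_neg_le mult_right_mono) auto
    also have "\<dots> \<le> - ln (real n)" using An by simp
    finally have "exp (exp 1 * R - 2 * exp 1 * A) \<le> exp (- ln (real n))" by simp
    also have "\<dots> = 1 / real n" using n by (simp add: exp_minus inverse_eq_divide)
    finally have "real K * exp (exp 1 * R - 2 * exp 1 * A) \<le> real K * (1 / real n)"
      by (intro mult_left_mono) auto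
    moreover have "real (card (arcs (G0 n))) \<le> real K" using assms(2)[OF n] by simp
    note prob_diameter_ge[OF l u this, of n "2 * exp 1 * A"]
    ultimately show "1 - real K / real n \<le> ?P n"
      by (simp add: graph_def R_def A_def algebra_simps)
  qed
  show "?P \<longlonglongrightarrow> 1"
  proof (rule tendsto_sandwich)
    show "\<forall>\<^sub>F n in sequentially. 1 - real K / real n \<le> ?P n" "\<forall>\<^sub>F n in sequentially. ?P n \<le> 1"
      using lower by (auto intro: eventually_sequentiallyI[of 1])
    show "(\<lambda>n. 1 - real K / real n) \<longlonglongrightarrow> 1"
      using tendsto_diff[OF tendsto_const lim_const_over_n[of "real K"], of 1] by simp
  qed simp
qed

end
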